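(* For $n\ge1$ let $t_n=(2n)^{n-1}$ be the number of rooted labeled directed trees on $\{1,\dots,n\}$ (each of which has exactly one kernel), and let $g_n$ be the number of them whose root does not belong to the kernel (root colored green in the unique well-coloring). Then $$\lim_{n\to\infty}\frac{g_n}{t_n}=\frac{1-\lambda}{1+\lambda}\approx 0.4795,$$ where $\lambda\approx0.351733$ is the unique real root of $2\lambda=\exp(-\lambda)$. Equivalently, in the game on a uniformly random rooted labeled directed tree of size $n$ where two players alternately move a token from its current vertex along an out-going arc, starting at the root, and the first player unable to move loses, the probability that the first player (with optimal play by both) wins tends to $\frac{1-\lambda}{1+\lambda}$.
   Context: A labeled directed tree on $\{1,\dots,n\}$ is a digraph whose underlying undirected graph is a tree, each edge oriented in one direction; rooted means one vertex is distinguished. A kernel of a digraph $(V,E)$ is a nonempty set $K\subseteq V$ with no arc between vertices of $K$ such that every vertex outside $K$ has an arc to a vertex of $K$. Equivalently, coloring kernel vertices red and others green gives a well-coloring: every green vertex has a red out-neighbour and no red vertex has a red out-neighbour. *)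

theory Defs
  imports "HOL-Probability.Probability" "Graph_Theory.Graph_Theory"
begin

text \<open>
  The library predicate \<open>tree\<close> excludes directed cycles only (so it admits the
  transitive triangle, and rejects the symmetric closure of a tree because of its cycles
  of length two).  A cycle of the underlying undirected graph is a cycle of the symmetric
  closure with at least three arcs.
\<close>
definition undirected_cycle :: "'a pair_pre_digraph \<Rightarrow> ('a \<times> 'a) awalk \<Rightarrow> bool" where
  "undirected_cycle G p \<longleftrightarrow>
     pre_digraph.cycle (with_proj (mk_symmetric (with_proj G))) p \<and> 3 \<le> length p"

text \<open>
  \<open>Digraph_Component.connected\<close> is connectedness of the underlying undirected graph and
  includes that there is at least one vertex.
\<close>
definition directed_tree :: "'a pair_pre_digraph \<Rightarrow> bool" where
  "directed_tree G \<longleftrightarrow>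
     pair_digraph G \<and>
     (\<forall>u v. (u, v) \<in> parcs G \<longrightarrow> (v, u) \<notin> parcs G) \<and>
     Digraph_Component.connected (with_proj G) \<and>
     \<not> (\<exists>p. undirected_cycle G p)"

definition rooted_directed_trees :: "nat \<Rightarrow> (nat pair_pre_digraph \<times> nat) set" where
  "rooted_directed_trees n =
     {(G, r). directed_tree G \<and> pverts G = {1..n} \<and> r \<in> pverts G}"

definition is_kernel :: "'a pair_pre_digraph \<Rightarrow> 'a set \<Rightarrow> bool" where
  "is_kernel G K \<longleftrightarrow>
     K \<noteq> {} \<and> K \<subseteq> pverts G \<and>
     (\<forall>u\<in>K. \<forall>v\<in>K. (u, v) \<notin> parcs G) \<and>
     (\<forall>u\<in>pverts G - K. \<exists>v\<in>K. (u, v) \<in> parcs G)"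

definition the_kernel :: "'a pair_pre_digraph \<Rightarrow> 'a set" where
  "the_kernel G = (THE K. is_kernel G K)"

definition t_num :: "nat \<Rightarrow> nat" where
  "t_num n = card (rooted_directed_trees n)"

definition g_num :: "nat \<Rightarrow> nat" where
  "g_num n = card {(G, r). (G, r) \<in> rooted_directed_trees n \<and> r \<notin> the_kernel G}"

text \<open>
  A position of the game, with its history, is a vertex walk from the starting vertex to
  the current vertex.  The player to move has to extend the walk by one arc.
\<close>
definition can_move :: "'a pair_pre_digraph \<Rightarrow> 'a list \<Rightarrow> bool" where
  "can_move G p \<longleftrightarrow> (\<exists>w. (last p, w) \<in> parcs G)"

definition complete_play :: "'a pair_pre_digraph \<Rightarrow> 'a \<Rightarrow> 'a list \<Rightarrow> bool" where
  "complete_play G r p \<longleftrightarrow> vwalk p (with_proj G) \<and> hd p = r \<and> \<not> can_move G p"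

definition strategy :: "'a pair_pre_digraph \<Rightarrow> ('a list \<Rightarrow> 'a) \<Rightarrow> bool" where
  "strategy G \<sigma> \<longleftrightarrow>
     (\<forall>p. vwalk p (with_proj G) \<and> can_move G p \<longrightarrow> (last p, \<sigma> p) \<in> parcs G)"

text \<open>The first player makes the moves from \<open>p ! i\<close> to \<open>p ! Suc i\<close> with \<open>i\<close> even.\<close>
definition first_player_follows :: "('a list \<Rightarrow> 'a) \<Rightarrow> 'a list \<Rightarrow> bool" where
  "first_player_follows \<sigma> p \<longleftrightarrow>
     (\<forall>i. even i \<and> Suc i < length p \<longrightarrow> p ! Suc i = \<sigma> (take (Suc i) p))"

text \<open>
  The first player wins a complete play iff the number \<open>length p - 1\<close> of moves is odd.
  Under optimal play by both, the first player wins iff she has a winning strategy.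
  Infinite plays do not occur in the finite directed trees considered here.
\<close>
definition first_player_wins :: "'a pair_pre_digraph \<Rightarrow> 'a \<Rightarrow> bool" where
  "first_player_wins G r \<longleftrightarrow>
     (\<exists>\<sigma>. strategy G \<sigma> \<and>
        (\<forall>p. complete_play G r p \<and> first_player_follows \<sigma> p \<longrightarrow> odd (length p - 1)))"

end

theory Submission
  imports Defs "HOL-Complex_Analysis.Complex_Analysis" "HOL-Real_Asymp.Real_Asymp"
begin

text \<open>
  Marking a vertex $v$ other than the root and cutting the unique arc at the root that separates
  it from $v$ splits a rooted tree into two rooted trees.  The root is in the kernel iff
  it is in the kernel of the part containing it and the arc does not lead from it to a
  kernel vertex of the other part.  For the exponential generating functions $T$ of all rooted
  directed trees and $R$ of those whose root is in the kernel this gives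
  $T = z e^{2T}$ and $R = z e^{2T-R}$, hence $T = R e^R$ and $R = z e^{h(R)}$ with
  $h(w) = 2 w e^w - w$.  By Lagrange inversion $n [z^n] R = [w^{n-1}] e^{n h(w)}$, and
  likewise for $T$ with $2w$ in place of $h(w)$.  As $h$ has nonnegative coefficients, the saddle
  point method applies to both on circles, of radius $\mu$ (where $\mu h'(\mu) = 1$ because of
  $2 \mu = e^{-\mu}$) and $1/2$ respectively.  The quotient tends to $2\mu/(1+\mu)$.
\<close>

unbundle no vec_syntax

section \<open>Lagrange inversion and the generating functions\<close>

text \<open>Marking a vertex replaces the unordered set of branches at the root by a cut into
  exactly two rooted trees, so the counts satisfy plain convolution recurrences. Such a recurrence
  has only one solution, so the counts can be identified with the coefficients of explicitly
  constructed series. The game enters only through the effect of the cut arc on the status of the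
  root, and eliminating \<open>T\<close> leaves an equation in \<open>R\<close> alone, to which
  Lagrange inversion in one variable applies. The limit arises as follows. Because of
  \<open>2 mu e^mu = 1\<close> the growth rate \<open>e^(h(mu)) / mu = e^(1 - mu) / mu\<close>
  equals \<open>2 e\<close>, which is also the rate \<open>e / (1/2)\<close> of the series for
  \<open>T\<close>; so the exponential growth cancels in the quotient. The index
  \<open>n - 1\<close> in place of \<open>n\<close> leaves the quotient \<open>2 mu\<close> of the
  two radii. The second-order terms at the saddle points are \<open>(1 + mu)^2\<close> and
  \<open>1\<close>, and their square roots supply the denominator \<open>1 + mu\<close>. The green
  roots are the complement: \<open>1 - 2 mu / (1 + mu) = (1 - mu) / (1 + mu)\<close>.\<close>

lemma fps_compose_mult_nth:
  fixes a b c :: "'a::comm_ring_1 fps"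
  assumes "b $ 0 = 0"
  shows "((a oo b) * c) $ n = (\<Sum>i\<le>n. a $ i * (b ^ i * c) $ n)"
proof -
  have z: "(b ^ i) $ j = 0" if "j < i" for i j
    using assms that by (rule startsby_zero_power_prefix[rule_format])
  have "((a oo b) * c) $ n = (\<Sum>j=0..n. (\<Sum>i=0..j. a $ i * (b ^ i) $ j) * c $ (n - j))"
    by (simp add: fps_mult_nth fps_compose_nth)
  \<comment> \<open>\<open>b ^ i\<close> has no terms below degree \<open>i\<close>, so the inner
    range can be made independent of \<open>j\<close>, which permits exchanging the sums.\<close>
  also have "\<dots> = (\<Sum>j=0..n. (\<Sum>i\<le>n. a $ i * (b ^ i) $ j) * c $ (n - j))"
    by (intro sum.cong refl arg_cong2[where f="(*)"] sum.mono_neutral_left) (auto simp: z)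
  also have "\<dots> = (\<Sum>i\<le>n. a $ i * (b ^ i * c) $ n)"
    by (simp add: fps_mult_nth sum_distrib_left sum_distrib_right mult.assoc sum.swap[of _ "{..n}"])
  finally show ?thesis .
qed

text \<open>Only meaningful for series without constant term, on which composition with \<^term>\<open>fps_exp 1\<close> is defined.\<close>
definition fexp :: "'a::field_char_0 fps \<Rightarrow> 'a fps" where
  "fexp h = fps_exp 1 oo h"

lemma fexp_0 [simp]: "fexp 0 = 1"
  by (simp add: fexp_def)

lemma fexp_nth_0 [simp]: "fexp h $ 0 = 1"
  by (simp add: fexp_def)

lemma fexp_deriv: "h $ 0 = 0 \<Longrightarrow> fps_deriv (fexp h) = fexp h * fps_deriv h"
  unfolding fexp_def by (subst fps_compose_deriv) simp_all

text \<open>Integrating factor: the product of \<open>f\<close> with the inverse of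
  \<open>fexp h\<close> has derivative zero and constant term 1. The addition law of
  \<open>fexp\<close> follows from this uniqueness.\<close>

lemma fexp_unique:
  fixes f h :: "'a::field_char_0 fps"
  assumes "f $ 0 = 1" "fps_deriv f = f * fps_deriv h" "h $ 0 = 0"
  shows "f = fexp h"
proof -
  define i where "i = inverse (fexp h)"
  have i: "fexp h * i = 1" by (simp add: i_def inverse_mult_eq_1')
  hence "fps_deriv (fexp h * i) = 0" by simp
  hence "i * (fexp h * fps_deriv i + fexp h * fps_deriv h * i) = 0"
    by (simp add: fexp_deriv assms)
  hence di: "fps_deriv i = - i * fps_deriv h" using i
    by (simp add: algebra_simps eq_neg_iff_add_eq_0) (metis (no_types) i mult.left_commute mult.right_neutral)
  have "fps_deriv (f * i) = 0"
    using assms by (simp add: di algebra_simps)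
  hence "f * i = fps_const ((f * i) $ 0)"
    by (subst (asm) fps_deriv_eq_0_iff)
  moreover have "i $ 0 = 1" by (simp add: i_def)
  ultimately have "f * i = 1" using assms by simp
  thus ?thesis using i by (metis mult.assoc mult.commute mult.right_neutral)
qed

lemma fexp_add: "g $ 0 = 0 \<Longrightarrow> h $ 0 = 0 \<Longrightarrow> fexp (g + h) = fexp g * fexp h"
  by (rule fexp_unique[symmetric]) (simp_all add: fexp_deriv algebra_simps)

lemma fexp_power: "h $ 0 = 0 \<Longrightarrow> fexp h ^ n = fexp (of_nat n * h)"
  by (induction n) (simp_all add: fexp_add ring_distribs)

lemma fexp_minus: "h $ 0 = 0 \<Longrightarrow> fexp (-h) * fexp h = 1"
  by (subst fexp_add[symmetric]) auto

lemma fexp_compose: "b $ 0 = 0 \<Longrightarrow> h $ 0 = 0 \<Longrightarrow> fexp h oo b = fexp (h oo b)"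
  by (simp add: fexp_def fps_compose_assoc)

text \<open>
  Compare the coefficients of index $n-1$ in $e^{nh} (G \circ F)' = e^{nh}$ for $F = w e^{-h}$: the
  summand of $G$ of index $k < n$ contributes, with $m = n - k$, the coefficient of $w^m$ in
  $(1 - w h') e^{mh} = e^{mh} - \frac{1}{m} w (e^{mh})'$, which is zero.
\<close>
lemma lagrange_inversion_exp:
  fixes h G :: "'a::field_char_0 fps"
  assumes h: "h $ 0 = 0" and inv: "G oo (fps_X * fexp (-h)) = fps_X" and n: "n > 0"
  shows "of_nat n * G $ n = fexp (of_nat n * h) $ (n - 1)"
proof -
  define F where "F = fps_X * fexp (-h)"
  define M where "M = fps_deriv F * fexp (of_nat n * h)"
  have dF: "fps_deriv F = (1 - fps_X * fps_deriv h) * fexp (-h)"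
    by (simp add: F_def fexp_deriv h algebra_simps)
  have "(fps_deriv G oo F) * fps_deriv F = 1"
    using arg_cong[OF inv, of fps_deriv] unfolding F_def[symmetric]
    by (subst (asm) fps_compose_deriv) (simp_all add: F_def)
  hence "fexp (of_nat n * h) $ (n - 1) = ((fps_deriv G oo F) * M) $ (n - 1)"
    by (simp add: M_def flip: mult.assoc)
  also have "\<dots> = (\<Sum>i\<le>n-1. fps_deriv G $ i * (F ^ i * M) $ (n - 1))"
    by (rule fps_compose_mult_nth) (simp add: F_def)
  also have "\<dots> = (\<Sum>i\<le>n-1. if i = n - 1 then of_nat n * G $ n else 0)"
  proof (intro sum.cong refl)
    fix i assume "i \<in> {..n-1}"
    hence "n = Suc i + (n - Suc i)" using n by auto
    then obtain m where m: "n = Suc i + m" by blast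
    have mh: "(of_nat m * h) $ 0 = 0" using h by simp
    have e: "fexp (- h) ^ Suc i * fexp (of_nat n * h) = fexp (of_nat m * h)"
      by (subst fexp_power) (simp_all add: h m algebra_simps flip: fexp_add)
    have "F ^ i * M = fps_X ^ i * (1 - fps_X * fps_deriv h) * (fexp (- h) ^ Suc i * fexp (of_nat n * h))"
      by (simp add: M_def dF) (simp add: F_def power_mult_distrib algebra_simps)
    hence "F ^ i * M = fps_X ^ i * ((1 - fps_X * fps_deriv h) * fexp (of_nat m * h))"
      unfolding e by (simp add: mult.assoc)
    hence eq: "(F ^ i * M) $ (n - 1) = ((1 - fps_X * fps_deriv h) * fexp (of_nat m * h)) $ m"
      by (simp add: m fps_X_power_mult_nth)
    show "fps_deriv G $ i * (F ^ i * M) $ (n - 1) = (if i = n - 1 then of_nat n * G $ n else 0)"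
    proof (cases m)
      case 0
      thus ?thesis using eq m by (simp add: h)
    next
      case (Suc k)
      have "fps_const (of_nat m) * ((1 - fps_X * fps_deriv h) * fexp (of_nat m * h))
          = fps_const (of_nat m) * fexp (of_nat m * h) - fps_X * fps_deriv (fexp (of_nat m * h))"
        by (subst fexp_deriv[OF mh]) (simp add: algebra_simps fps_of_nat)
      from arg_cong[OF this, of "\<lambda>x. x $ m"]
      have "of_nat m * ((1 - fps_X * fps_deriv h) * fexp (of_nat m * h)) $ m = 0"
        by (simp add: Suc)
      hence "((1 - fps_X * fps_deriv h) * fexp (of_nat m * h)) $ m = 0"
        using Suc by (simp del: of_nat_Suc)
      thus ?thesis using eq m Suc by simp
    qed
  qed
  also have "\<dots> = of_nat n * G $ n" by simp
  finally show ?thesis by simp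
qed


text \<open>The fixed point equation makes \<open>G\<close> a right inverse of
  \<open>F = z e^(-h)\<close> under composition. As \<open>F\<close> has a nonzero linear term,
  \<open>G\<close> must be its two-sided inverse \<open>fps_inv F\<close>, which turns the equation
  around into the form required before.\<close>

lemma lagrange_inversion_exp':
  fixes h G :: "'a::field_char_0 fps"
  assumes h: "h $ 0 = 0" and G: "G $ 0 = 0" "G = fps_X * fexp (h oo G)" and n: "n > 0"
  shows "of_nat n * G $ n = fexp (of_nat n * h) $ (n - 1)"
proof (rule lagrange_inversion_exp[OF h _ n])
  define F where "F = fps_X * fexp (-h)"
  have F: "F $ 0 = 0" "F $ 1 \<noteq> 0" by (simp_all add: F_def)
  have hG: "(h oo G) $ 0 = 0" using h G(1) by simp
  have "F oo G = G * fexp (-(h oo G))"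
    using h G(1) by (simp add: F_def fps_compose_mult_distrib fexp_compose fps_compose_uminus)
  also have "\<dots> = fps_X * (fexp (-(h oo G)) * fexp (h oo G))"
    by (subst G(2)) (simp add: mult_ac)
  also have "\<dots> = fps_X" by (subst fexp_minus[OF hG]) simp
  finally have "F oo G = fps_X" .
  hence "fps_inv F oo (F oo G) = fps_inv F" by simp
  hence "G = fps_inv F"
    using F G(1) by (simp add: fps_compose_assoc fps_inv)
  thus "G oo (fps_X * fexp (-h)) = fps_X"
    using F by (simp add: fps_inv flip: F_def)
qed

text \<open>
  The recurrence for the coefficients $t$ and $r$ of the exponential generating functions of all
  rooted trees and of those with the root in the kernel.  It expresses $z A' = A + A z B'$, the
  logarithmic derivative of $A = z e^B$, for $(A, B) = (T, 2T)$ and $(A, B) = (R, 2T - R)$.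
\<close>
definition coeff_recurrence :: "(nat \<Rightarrow> 'a::field_char_0) \<Rightarrow> (nat \<Rightarrow> 'a::field_char_0) \<Rightarrow> bool" where
  "coeff_recurrence t r \<longleftrightarrow> t 1 = 1 \<and> r 1 = 1 \<and>
     (\<forall>n\<ge>2. (of_nat n - 1) * t n = (\<Sum>k=1..n-1. t k * (of_nat (n - k) * (2 * t (n - k))))) \<and>
     (\<forall>n\<ge>2. (of_nat n - 1) * r n = (\<Sum>k=1..n-1. r k * (of_nat (n - k) * (2 * t (n - k) - r (n - k)))))"

text \<open>This links the tree counts to the formal series: both solve the recurrence, so no
  functional equation has to be proved for the counting series themselves. The factor
  \<open>n - 1\<close> can be cancelled from \<open>n = 2\<close> on.\<close>

lemma coeff_recurrence_unique:
  assumes A: "coeff_recurrence t r" "coeff_recurrence t' r'" and n: "n \<ge> 1"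
  shows "t n = t' n \<and> r n = r' n"
  using n
proof (induction n rule: less_induct)
  case (less n)
  show ?case
  proof (cases "n = 1")
    case True
    thus ?thesis using A by (simp add: coeff_recurrence_def)
  next
    case False
    hence n: "n \<ge> 2" using less.prems by simp
    have IH: "t k = t' k \<and> r k = r' k" if "k \<in> {1..n-1}" for k
      using less.IH[of k] that n by auto
    have IH2: "t (n - k) = t' (n - k) \<and> r (n - k) = r' (n - k)" if "k \<in> {1..n-1}" for k
      using less.IH[of "n - k"] that n by auto
    have "(of_nat n - 1) * t n = (of_nat n - 1) * t' n"
      using A n IH IH2 by (simp add: coeff_recurrence_def)
    moreover have "(of_nat n - 1) * r n = (of_nat n - 1) * r' n"
      using A n IH IH2 by (simp add: coeff_recurrence_def)
    ultimately show ?thesis using n by simp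
  qed
qed

text \<open>The argument of \<open>fps_inv\<close> is \<open>w e^(-h(w))\<close> with
  \<open>h(w) = 2 w e^w - w\<close>; inverting it yields a solution of \<open>R = z e^(h(R))\<close>
  without an existence proof.\<close>

definition tree_fps_R :: "'a::field_char_0 fps" where
  "tree_fps_R = fps_inv (fps_X * fexp (fps_X - 2 * (fps_X * fexp fps_X)))"

definition tree_fps_T :: "'a::field_char_0 fps" where
  "tree_fps_T = tree_fps_R * fexp tree_fps_R"

lemma tree_fps_R_0 [simp]: "tree_fps_R $ 0 = 0"
  by (simp add: tree_fps_R_def fps_inv_def)

lemma tree_fps_T_0 [simp]: "tree_fps_T $ 0 = 0"
  by (simp add: tree_fps_T_def)

lemma tree_fps_R_eq: "(tree_fps_R :: 'a::field_char_0 fps) = fps_X * fexp (2 * tree_fps_T - tree_fps_R)"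
proof -
  let ?g = "fps_X - 2 * (fps_X * fexp fps_X) :: 'a fps"
  let ?R = "tree_fps_R :: 'a fps"
  have "(fps_X * fexp ?g) oo ?R = fps_X"
    unfolding tree_fps_R_def by (rule fps_inv_right) simp_all
  hence "?R * fexp (?R - 2 * tree_fps_T) = fps_X"
    by (simp add: fps_compose_mult_distrib fexp_compose fps_compose_sub_distrib tree_fps_T_def
        numeral_fps_const)
  hence "fps_X * fexp (2 * tree_fps_T - ?R) =
      ?R * (fexp (- (2 * tree_fps_T - ?R)) * fexp (2 * tree_fps_T - ?R))"
    by (simp add: mult_ac)
  also have "\<dots> = ?R" by (subst fexp_minus) simp_all
  finally show ?thesis by simp
qed

lemma tree_fps_T_eq: "tree_fps_T = fps_X * fexp (2 * tree_fps_T)"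
proof -
  have "tree_fps_T = fps_X * (fexp (2 * tree_fps_T - tree_fps_R) * fexp tree_fps_R)"
    unfolding tree_fps_T_def by (subst (1) tree_fps_R_eq) (simp add: tree_fps_T_def mult_ac)
  thus ?thesis by (simp flip: fexp_add)
qed

lemma fps_logarithmic_nth:
  fixes A B :: "'a::field_char_0 fps"
  assumes A: "A = fps_X * fexp B" and B: "B $ 0 = 0" and n: "n \<ge> 2"
  shows "(of_nat n - 1) * A $ n = (\<Sum>k=1..n-1. A $ k * (of_nat (n - k) * B $ (n - k)))"
proof -
  have "fps_X * fps_deriv A = A + A * (fps_X * fps_deriv B)"
    by (subst (1 2 3) A) (simp add: fexp_deriv B algebra_simps)
  from arg_cong[OF this, of "\<lambda>x. x $ n"] n
  have "of_nat n * A $ n = A $ n + (A * (fps_X * fps_deriv B)) $ n"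
    by simp
  also have "(A * (fps_X * fps_deriv B)) $ n = (\<Sum>k=0..n. A $ k * (fps_X * fps_deriv B) $ (n - k))"
    by (rule fps_mult_nth)
  \<comment> \<open>The summands \<open>k = 0\<close> and \<open>k = n\<close> vanish because
    neither \<open>A\<close> nor \<open>z B'\<close> has a constant term.\<close>
  also have "(\<Sum>k=0..n. A $ k * (fps_X * fps_deriv B) $ (n - k))
      = (\<Sum>k=1..n-1. A $ k * (fps_X * fps_deriv B) $ (n - k))"
  proof (intro sum.mono_neutral_right ballI)
    fix k assume "k \<in> {0..n} - {1..n-1}"
    hence "k = 0 \<or> k = n" by auto
    moreover have "A $ 0 = 0" by (subst A) simp
    ultimately show "A $ k * (fps_X * fps_deriv B) $ (n - k) = 0" by auto
  qed auto
  also have "\<dots> = (\<Sum>k=1..n-1. A $ k * (of_nat (n - k) * B $ (n - k)))"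
    by (intro sum.cong refl) (auto simp: Suc_diff_Suc)
  finally show ?thesis by (simp add: algebra_simps)
qed

lemma tree_fps_recurrence: "coeff_recurrence (fps_nth tree_fps_T) (fps_nth tree_fps_R)"
  unfolding coeff_recurrence_def
proof (intro conjI allI impI)
  show "tree_fps_T $ 1 = 1" by (subst tree_fps_T_eq) simp
  show "tree_fps_R $ 1 = 1" by (subst tree_fps_R_eq) simp
qed (subst fps_logarithmic_nth[OF tree_fps_T_eq] fps_logarithmic_nth[OF tree_fps_R_eq];
     simp add: numeral_fps_const)+

lemma tree_fps_T_nth:
  assumes "n > 0"
  shows "of_nat n * tree_fps_T $ n = fexp (of_nat n * (2 * fps_X)) $ (n - 1)"
  by (rule lagrange_inversion_exp'[OF _ _ _ assms])
     (simp_all add: fps_compose_mult_distrib numeral_fps_const flip: tree_fps_T_eq[unfolded numeral_fps_const])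

lemma tree_fps_R_nth:
  assumes "n > 0"
  shows "of_nat n * tree_fps_R $ n = fexp (of_nat n * (2 * (fps_X * fexp fps_X) - fps_X)) $ (n - 1)"
  by (rule lagrange_inversion_exp'[OF _ _ _ assms], simp, simp, subst (1) tree_fps_R_eq)
     (simp add: fps_compose_mult_distrib fexp_compose fps_compose_sub_distrib tree_fps_T_def numeral_fps_const)

lemma fexp_linear_nth: "fexp (fps_const c * fps_X) $ n = c ^ n / fact n"
proof -
  have "fps_exp c = fexp (fps_const c * fps_X)"
    by (rule fexp_unique) simp_all
  hence "fexp (fps_const c * fps_X) $ n = fps_exp c $ n" by simp
  thus ?thesis by simp
qed

text \<open>Two forms are kept for \<open>t\<close>: the closed one counts the trees, while the
  coefficient of an exponential lets \<open>t\<close> and \<open>r\<close> go through the same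
  saddle point argument, so that Stirling's formula is not called for.\<close>

lemma coeff_recurrence_solution:
  assumes "coeff_recurrence t r" "n \<ge> 1"
  shows "of_nat n * t n = (2 * of_nat n) ^ (n - 1) / fact (n - 1)"
    and "of_nat n * t n = fexp (of_nat n * (2 * fps_X)) $ (n - 1)"
    and "of_nat n * r n = fexp (of_nat n * (2 * (fps_X * fexp fps_X) - fps_X)) $ (n - 1)"
proof -
  note * = coeff_recurrence_unique[OF assms(1) tree_fps_recurrence assms(2)]
  show t: "of_nat n * t n = fexp (of_nat n * (2 * fps_X)) $ (n - 1)"
    using * tree_fps_T_nth[of n] assms(2) by simp
  show "of_nat n * r n = fexp (of_nat n * (2 * (fps_X * fexp fps_X) - fps_X)) $ (n - 1)"
    using * tree_fps_R_nth[of n] assms(2) by simp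
  have "of_nat n * (2 * fps_X) = fps_const (2 * of_nat n :: 'a) * fps_X"
    by (simp add: numeral_fps_const mult_ac flip: fps_of_nat fps_const_mult)
  thus "of_nat n * t n = (2 * of_nat n) ^ (n - 1) / fact (n - 1)"
    by (simp only: t fexp_linear_nth)
qed

section \<open>Coefficient asymptotics\<close>

text \<open>Cauchy's formula is applied to \<open>f (- u)\<close> instead of \<open>f u\<close>:
  this moves the start of the circle from \<open>r\<close> to \<open>-r\<close>, so that the angle
  runs over \<open>{-pi..pi}\<close>, with the later saddle point in the middle. The signs
  \<open>(-1) ^ k\<close> cancel.\<close>

lemma coefficient_integral:
  fixes f :: "complex \<Rightarrow> complex"
  assumes hol: "f holomorphic_on UNIV" and F: "f has_fps_expansion F" and r: "r > 0"
  shows "of_real (2 * pi * r ^ k) * F $ k =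
         (LINT x:{-pi..pi}|lborel. f (of_real r * cis x) * cis (- (real k * x)))"
proof -
  define \<phi> where "\<phi> = (\<lambda>x. f (of_real r * cis x) * cis (- (real k * x)))"
  have contf: "continuous_on A f" for A
    using hol by (meson continuous_on_subset holomorphic_on_imp_continuous_on subset_UNIV)
  have cont: "continuous_on A (\<lambda>t. \<phi> (-pi + 2 * pi * t))" for A
    unfolding \<phi>_def by (intro continuous_intros continuous_on_compose2[OF contf[of UNIV]]) auto
  have dg: "(deriv ^^ k) (\<lambda>w. f (- w)) 0 = (-1) ^ k * (deriv ^^ k) f 0"
    using higher_deriv_compose_linear[OF hol, of UNIV 0 "-1" k] by simp
  have Fk: "F $ k = (deriv ^^ k) f 0 / fact k"
    by (rule fps_nth_fps_expansion) fact
  have hol': "(\<lambda>w. f (- w)) holomorphic_on UNIV"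
    using holomorphic_on_compose[of uminus UNIV f] hol
    by (simp add: o_def holomorphic_on_minus holomorphic_on_ident surj_def)
  have "((\<lambda>u. f (- u) / (u - 0) ^ (Suc k)) has_contour_integral
          (2 * pi * \<i>) / fact k * (deriv ^^ k) (\<lambda>w. f (- w)) 0) (circlepath 0 r)"
    using r by (intro Cauchy_has_contour_integral_higher_derivative_circlepath)
      (auto intro: holomorphic_on_subset[OF hol'] holomorphic_on_imp_continuous_on)
  hence "((\<lambda>t. f (- circlepath 0 r t) / circlepath 0 r t ^ (Suc k) *
             vector_derivative (circlepath 0 r) (at t within {0..1})) has_integral
          (2 * pi * \<i>) * (-1) ^ k * F $ k) {0..1}"
    by (simp add: has_contour_integral_def dg Fk mult_ac)
  hence "((\<lambda>t. (2 * pi * \<i>) * (-1) ^ k / r ^ k * \<phi> (-pi + 2 * pi * t)) has_integral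
          (2 * pi * \<i>) * (-1) ^ k * F $ k) {0..1}"
  proof (rule has_integral_eq[rotated])
    fix t :: real assume t: "t \<in> {0..1}"
    have c: "circlepath 0 r t = r * cis (2 * pi * t)"
      by (simp add: circlepath cis_conv_exp mult_ac)
    have c': "- circlepath 0 r t = r * cis (-pi + 2 * pi * t)"
      by (simp add: c complex_eq_iff cos_diff sin_diff)
    have v: "vector_derivative (circlepath 0 r) (at t within {0..1}) = 2 * pi * \<i> * r * cis (2 * pi * t)"
      using t by (subst vector_derivative_circlepath01) (auto simp: cis_conv_exp mult_ac)
    have p: "cis (- (real k * (-pi + 2 * pi * t))) = (-1) ^ k / cis (2 * pi * t) ^ k"
    proof -
      have "cis (- (real k * (-pi + 2 * pi * t))) = cis (- (-pi + 2 * pi * t)) ^ k"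
        by (simp only: Complex.DeMoivre mult_minus_right)
      also have "cis (- (-pi + 2 * pi * t)) = -1 / cis (2 * pi * t)"
        by (simp flip: cis_pi cis_divide)
      finally show ?thesis by (simp only: power_divide)
    qed
    show "f (- circlepath 0 r t) / circlepath 0 r t ^ (Suc k) *
             vector_derivative (circlepath 0 r) (at t within {0..1}) =
          (2 * pi * \<i>) * (-1) ^ k / r ^ k * \<phi> (-pi + 2 * pi * t)"
      unfolding v c' \<phi>_def p unfolding c using r
      by (simp add: field_simps power_mult_distrib)
  qed
  hence "((\<lambda>t. r ^ k / ((2 * pi * \<i>) * (-1) ^ k) * ((2 * pi * \<i>) * (-1) ^ k / r ^ k * \<phi> (-pi + 2 * pi * t))) has_integral
          r ^ k / ((2 * pi * \<i>) * (-1) ^ k) * ((2 * pi * \<i>) * (-1) ^ k * F $ k)) {0..1}"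
    by (rule has_integral_mult_right)
  hence I: "((\<lambda>t. \<phi> (-pi + 2 * pi * t)) has_integral r ^ k * F $ k) {0..1}"
    using r by (simp add: field_simps)
  have "(LINT x:{-pi..pi}|lborel. \<phi> x) = (2 * pi) *\<^sub>R (LINT t|lborel. indicator {-pi..pi} (-pi + 2 * pi * t) *\<^sub>R \<phi> (-pi + 2 * pi * t))"
    unfolding set_lebesgue_integral_def
    by (subst lborel_integral_real_affine[of "2 * pi" _ "-pi"]) auto
  also have "(\<lambda>t. indicator {-pi..pi} (-pi + 2 * pi * t) :: real) = indicator {0..1}"
    using pi_gt_zero by (auto simp: indicator_def fun_eq_iff zero_le_mult_iff simp del: pi_gt_zero)
  also have "(LINT t|lborel. indicator {0..1} t *\<^sub>R \<phi> (-pi + 2 * pi * t)) = (LINT t:{0..1}|lborel. \<phi> (-pi + 2 * pi * t))"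
    by (simp add: set_lebesgue_integral_def)
  also have "\<dots> = integral {0..1} (\<lambda>t. \<phi> (-pi + 2 * pi * t))"
    by (intro set_borel_integral_eq_integral borel_integrable_atLeastAtMost' cont)
  also have "\<dots> = r ^ k * F $ k" using I by (rule integral_unique)
  finally show ?thesis by (simp add: \<phi>_def scaleR_conv_of_real mult_ac)
qed

text \<open>The power series of \<open>f\<close> begins with 0, 0, \<open>d / 2\<close>; divided by
  \<open>z ^ 2\<close> it is continuous at 0 with value \<open>d / 2\<close>. That \<open>d\<close>
  is nonzero keeps the series nonzero, so that its \<open>subdegree\<close> is at least 2.\<close>

lemma quadratic_limit_at_0:
  fixes f f' :: "complex \<Rightarrow> complex"
  assumes f': "\<And>z. (f has_field_derivative f' z) (at z)" and d: "(f' has_field_derivative d) (at 0)"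
    and 0: "f 0 = 0" "f' 0 = 0" and "d \<noteq> 0"
  shows "((\<lambda>z. f z / z ^ 2) \<longlongrightarrow> d / 2) (at 0)"
proof -
  have "f holomorphic_on UNIV"
    using f' by (auto simp: holomorphic_on_open)
  then obtain F where F: "f has_fps_expansion F"
    using has_fps_expansion_fps_expansion[of UNIV f] by auto
  have df: "deriv f = f'" using f' DERIV_imp_deriv by blast
  have F0: "F $ 0 = 0" using fps_nth_fps_expansion[OF F, of 0] 0 by simp
  have F1: "F $ 1 = 0" using fps_nth_fps_expansion[OF F, of 1] 0 by (simp add: df)
  have F2: "F $ 2 = d / 2" using fps_nth_fps_expansion[OF F, of 2] DERIV_imp_deriv[OF d]
    by (simp add: df numeral_2_eq_2)
  have "F \<noteq> 0" using F2 \<open>d \<noteq> 0\<close> by auto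
  hence "subdegree F \<ge> 2"
    using F0 F1 by (intro subdegree_geI) (auto simp: less_2_cases_iff)
  from has_fps_expansion_shift[OF F this F2[symmetric]]
  have "((\<lambda>x. if x = 0 then d / 2 else f x / x ^ 2) \<longlongrightarrow> d / 2) (at 0)"
    by (drule_tac has_fps_expansion_imp_continuous[of _ _ UNIV]) (simp add: continuous_within)
  thus ?thesis
    by (rule Lim_transform_eventually) (auto simp: eventually_at_filter)
qed

lemma has_fps_expansion_exp_compose:
  assumes "h has_fps_expansion H" "H $ 0 = 0"
  shows "(\<lambda>z::complex. exp (h z)) has_fps_expansion (fps_exp 1 oo H)"
  using has_fps_expansion_compose[OF has_fps_expansion_exp1 assms] by (simp add: o_def)

lemma gaussian_integral_scaled:
  fixes c :: real
  assumes "c > 0"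
  shows "has_bochner_integral lborel (\<lambda>x. exp (- (c * x\<^sup>2) / 2)) (sqrt (2 * pi) / sqrt c)"
proof -
  have "has_bochner_integral lborel (\<lambda>x. (sqrt (2 * pi) / sqrt c) * normal_density 0 (1 / sqrt c) x)
          ((sqrt (2 * pi) / sqrt c) * 1)"
    using assms by (intro has_bochner_integral_mult_right)
      (auto simp: has_bochner_integral_iff)
  also have "(\<lambda>x. (sqrt (2 * pi) / sqrt c) * normal_density 0 (1 / sqrt c) x) = (\<lambda>x. exp (- (c * x\<^sup>2) / 2))"
    using assms by (auto simp: normal_density_def fun_eq_iff power_divide real_sqrt_divide real_sqrt_mult field_simps)
  finally show ?thesis by simp
qed

text \<open>On the circle of radius \<open>lam\<close> the normalised coefficient is an integral of
  \<open>exp (n * \<Lambda> x) * cis x\<close>. The saddle equation removes the linear term of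
  \<open>\<Lambda>\<close>, leaving \<open>- \<sigma>\<^sup>2 * x\<^sup>2 / 2\<close> to second
  order. After scaling by \<open>sqrt n\<close> the integrand tends to a Gaussian, and
  \<open>bound\<close> dominates it on the whole circle, so central part and tails need no separate
  treatment.\<close>

lemma saddle_point_coeff_limit:
  fixes h h' h'' :: "complex \<Rightarrow> complex" and lam \<sigma> c :: real and E :: "nat \<Rightarrow> complex fps"
  assumes dh: "\<And>z. (h has_field_derivative h' z) (at z)"
    and dh': "\<And>z. (h' has_field_derivative h'' z) (at z)"
    and pos: "lam > 0" "\<sigma> > 0" "c > 0"
    and saddle: "lam * h' lam = 1"
    and var: "1 + lam\<^sup>2 * h'' lam = \<sigma>\<^sup>2"
    and bound: "\<And>x. \<bar>x\<bar> \<le> pi \<Longrightarrow> Re (h (lam * cis x)) \<le> Re (h lam) - c * x\<^sup>2"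
    and E: "\<And>n. (\<lambda>z. exp (of_nat n * h z)) has_fps_expansion E n"
  shows "(\<lambda>n. of_real (sqrt n * lam ^ (n - 1)) * exp (- (of_nat n * h lam)) * E n $ (n - 1))
           \<longlonglongrightarrow> of_real (1 / (sqrt (2 * pi) * \<sigma>))"
proof -
  define \<Lambda> where "\<Lambda> = (\<lambda>z. h (lam * exp (\<i> * z)) - h lam - \<i> * z)"
  define \<Lambda>' where "\<Lambda>' = (\<lambda>z. \<i> * (lam * exp (\<i> * z)) * h' (lam * exp (\<i> * z)) - \<i>)"
  have \<Lambda>': "(\<Lambda> has_field_derivative \<Lambda>' z) (at z)" for z
    unfolding \<Lambda>_def \<Lambda>'_def
    by (rule derivative_eq_intros DERIV_chain2[OF dh] refl | simp)+
  \<comment> \<open>The saddle equation turns \<open>lam * h' lam\<close> into 1, after which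
    \<open>var\<close> identifies the second derivative as minus the square of
    \<open>\<sigma>\<close>.\<close>
  have "(\<Lambda>' has_field_derivative - (lam * h' lam + lam\<^sup>2 * h'' lam)) (at 0)"
    unfolding \<Lambda>'_def
    by (rule derivative_eq_intros DERIV_chain2[OF dh'] refl | simp add: algebra_simps power2_eq_square)+
  hence \<Lambda>'': "(\<Lambda>' has_field_derivative - of_real (\<sigma>\<^sup>2)) (at 0)"
    unfolding saddle var .
  have quad: "((\<lambda>z. \<Lambda> z / z ^ 2) \<longlongrightarrow> - of_real (\<sigma>\<^sup>2) / 2) (at 0)"
    using pos saddle by (intro quadratic_limit_at_0[OF \<Lambda>' \<Lambda>'']) (auto simp: \<Lambda>_def \<Lambda>'_def mult.assoc)
  have cont\<Lambda>: "continuous_on A \<Lambda>" for A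
    using \<Lambda>' by (meson DERIV_isCont continuous_at_imp_continuous_on)
  have holE: "(\<lambda>z. exp (of_nat n * h z)) holomorphic_on UNIV" for n
  proof -
    have "h holomorphic_on UNIV" using dh by (auto simp: holomorphic_on_open)
    thus ?thesis by (intro holomorphic_intros)
  qed
  \<comment> \<open>The value 0 at \<open>n = 0\<close> matters: as \<open>x / sqrt 0 = 0\<close>,
    the formula would give the constant 1 there, which no integrable function dominates.\<close>
  define G where "G = (\<lambda>(n::nat) (x::real). if n = 0 then 0 else indicator {-pi..pi} (x / sqrt n) *\<^sub>R
                        (exp (of_nat n * \<Lambda> (x / sqrt n)) * cis (x / sqrt n)))"
  have G_meas: "G n \<in> borel_measurable lborel" for n
  proof -
    have "(\<lambda>x::real. exp (of_nat n * \<Lambda> (x / sqrt n)) * cis (x / sqrt n)) \<in> borel_measurable borel"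
      by (cases "n = 0") (auto intro!: borel_measurable_continuous_onI continuous_intros continuous_on_compose2[OF cont\<Lambda>[of UNIV]])
    thus ?thesis unfolding G_def by (cases "n = 0") simp_all
  qed
  have step1: "of_real (2 * pi) * (of_real (sqrt n * lam ^ (n - 1)) * exp (- (of_nat n * h lam)) * E n $ (n - 1)) = (LINT x|lborel. G n x)"
    if n: "n > 0" for n
  proof -
    have "of_real (2 * pi * lam ^ (n - 1)) * E n $ (n - 1) * exp (- (of_nat n * h lam))
        = (LINT x:{-pi..pi}|lborel. exp (of_nat n * h (lam * cis x)) * cis (- (real (n - 1) * x))) * exp (- (of_nat n * h lam))"
      by (subst coefficient_integral[OF holE E pos(1)]) simp
    also have "\<dots> = (LINT x|lborel. indicator {-pi..pi} x *\<^sub>R (exp (of_nat n * h (lam * cis x)) * cis (- (real (n - 1) * x)) * exp (- (of_nat n * h lam))))"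
      unfolding set_lebesgue_integral_def by (subst integral_mult_left_zero[symmetric]) simp
    also have "\<dots> = (LINT x|lborel. indicator {-pi..pi} x *\<^sub>R (exp (of_nat n * \<Lambda> x) * cis x))"
    proof (intro Bochner_Integration.integral_cong refl arg_cong2[where f=scaleR])
      fix x :: real
      have "real (n - 1) = real n - 1" using n by simp
      thus "exp (of_nat n * h (lam * cis x)) * cis (- (real (n - 1) * x)) * exp (- (of_nat n * h lam))
          = exp (of_nat n * \<Lambda> x) * cis x"
        by (simp add: \<Lambda>_def cis_conv_exp algebra_simps flip: exp_add)
    qed
    also have "\<dots> = (1 / sqrt n) *\<^sub>R (LINT x|lborel. G n x)"
      using n by (subst lborel_integral_real_affine[of "1 / sqrt n" _ 0]) (simp_all add: G_def)
    finally show ?thesis using n by (simp add: field_simps scaleR_conv_of_real)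
  qed
  have "(\<lambda>n. LINT x|lborel. G n x) \<longlonglongrightarrow> (LINT x|lborel. of_real (exp (- (\<sigma>\<^sup>2 * x\<^sup>2) / 2)))"
  proof (rule integral_dominated_convergence)
    show "integrable lborel (\<lambda>x. exp (- ((2 * c) * x\<^sup>2) / 2))"
      using gaussian_integral_scaled[of "2 * c"] pos by (simp add: has_bochner_integral_iff)
    show "AE x in lborel. norm (G n x) \<le> exp (- ((2 * c) * x\<^sup>2) / 2)" for n
    proof (intro AE_I2)
      fix x :: real
      show "norm (G n x) \<le> exp (- ((2 * c) * x\<^sup>2) / 2)"
      proof (cases "n > 0 \<and> \<bar>x / sqrt n\<bar> \<le> pi")
        case True
        \<comment> \<open>The summand \<open>\<i> * z\<close> of \<open>\<Lambda>\<close> is purely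
          imaginary at real points, so \<open>bound\<close> carries over, and the scaling cancels
          \<open>n\<close>.\<close>
        hence "n * Re (\<Lambda> (x / sqrt n)) \<le> n * (- c * (x / sqrt n)\<^sup>2)"
          using bound[of "x / sqrt n"] by (intro mult_left_mono) (auto simp: \<Lambda>_def cis_conv_exp)
        also have "\<dots> = - c * x\<^sup>2" using True by (simp add: power_divide)
        finally show ?thesis by (simp add: G_def norm_mult indicator_def)
      next
        case False
        thus ?thesis
          by (cases "n = 0") (auto simp: G_def abs_le_iff indicator_def not_le norm_mult)
      qed
    qed
    show "AE x in lborel. (\<lambda>n. G n x) \<longlonglongrightarrow> of_real (exp (- (\<sigma>\<^sup>2 * x\<^sup>2) / 2))"
    proof (intro AE_I2)
      fix x :: real
      have x0: "(\<lambda>n. x / sqrt n) \<longlonglongrightarrow> 0" by real_asymp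
      have "\<forall>\<^sub>F n in sequentially. \<bar>x / sqrt n\<bar> < pi"
        by (rule order_tendstoD(2)[OF tendsto_rabs_zero[OF x0] pi_gt_zero])
      hence ev: "\<forall>\<^sub>F n in sequentially. exp (of_nat n * \<Lambda> (x / sqrt n)) * cis (x / sqrt n) = G n x"
        using eventually_gt_at_top[of 0]
      proof eventually_elim
        case (elim n)
        have "- pi \<le> x / sqrt n" "x / sqrt n \<le> pi" using elim(1) by linarith+
        thus ?case using elim(2) by (simp add: G_def)
      qed
      \<comment> \<open>\<open>quad\<close> is a limit at a punctured point, so
        \<open>x = 0\<close>, where the sequence is constantly 0, is treated apart.\<close>
      have "(\<lambda>n. of_nat n * \<Lambda> (x / sqrt n)) \<longlonglongrightarrow> - of_real (\<sigma>\<^sup>2) / 2 * of_real (x\<^sup>2)"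
      proof (cases "x = 0")
        case True
        thus ?thesis by (simp add: \<Lambda>_def)
      next
        case False
        have "filterlim (\<lambda>n::nat. complex_of_real (x / sqrt n)) (at 0) sequentially"
          unfolding filterlim_at
        proof
          show "(\<lambda>n. complex_of_real (x / sqrt n)) \<longlonglongrightarrow> 0"
            using tendsto_of_real[OF x0, where 'a=complex] by simp
          show "\<forall>\<^sub>F n::nat in sequentially. complex_of_real (x / sqrt n) \<in> UNIV \<and> complex_of_real (x / sqrt n) \<noteq> 0"
            using eventually_gt_at_top[of 0] by eventually_elim (use False in auto)
        qed
        from filterlim_compose[OF quad this]
        have "(\<lambda>n. \<Lambda> (x / sqrt n) / (of_real (x / sqrt n))\<^sup>2 * of_real (x\<^sup>2)) \<longlonglongrightarrow> - of_real (\<sigma>\<^sup>2) / 2 * of_real (x\<^sup>2)"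
          by (rule tendsto_mult[OF _ tendsto_const])
        moreover have "\<forall>\<^sub>F n::nat in sequentially. \<Lambda> (x / sqrt n) / (of_real (x / sqrt n))\<^sup>2 * of_real (x\<^sup>2) = of_nat n * \<Lambda> (x / sqrt n)"
          using eventually_gt_at_top[of 0]
        proof eventually_elim
          case (elim n)
          have "(of_real (x / sqrt n))\<^sup>2 = (of_real (x\<^sup>2 / n) :: complex)"
            using elim by (simp add: power_divide flip: of_real_power)
          thus ?case using False elim by (simp add: field_simps)
        qed
        ultimately show ?thesis by (rule Lim_transform_eventually)
      qed
      hence "(\<lambda>n. exp (of_nat n * \<Lambda> (x / sqrt n)) * cis (x / sqrt n)) \<longlonglongrightarrow> exp (- of_real (\<sigma>\<^sup>2) / 2 * of_real (x\<^sup>2)) * cis 0"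
        by (rule tendsto_mult[OF tendsto_exp]) (intro tendsto_intros x0)
      from Lim_transform_eventually[OF this ev]
      show "(\<lambda>n. G n x) \<longlonglongrightarrow> of_real (exp (- (\<sigma>\<^sup>2 * x\<^sup>2) / 2))"
        by (simp flip: exp_of_real)
    qed
  qed (use G_meas in auto)
  also have "(LINT x|lborel. complex_of_real (exp (- (\<sigma>\<^sup>2 * x\<^sup>2) / 2))) = of_real (sqrt (2 * pi) / \<sigma>)"
    using gaussian_integral_scaled[of "\<sigma>\<^sup>2"] pos by (simp add: has_bochner_integral_iff)
  finally have "(\<lambda>n. (LINT x|lborel. G n x) / of_real (2 * pi)) \<longlonglongrightarrow> of_real (sqrt (2 * pi) / \<sigma>) / of_real (2 * pi)"
    by (intro tendsto_intros) auto
  moreover have "\<forall>\<^sub>F n in sequentially. (LINT x|lborel. G n x) / of_real (2 * pi) = 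
      of_real (sqrt n * lam ^ (n - 1)) * exp (- (of_nat n * h lam)) * E n $ (n - 1)"
    using eventually_gt_at_top[of 0] by eventually_elim (simp flip: step1)
  ultimately have "(\<lambda>n. of_real (sqrt n * lam ^ (n - 1)) * exp (- (of_nat n * h lam)) * E n $ (n - 1)) \<longlonglongrightarrow>
      of_real (sqrt (2 * pi) / \<sigma>) / of_real (2 * pi)"
    by (rule Lim_transform_eventually)
  also have "of_real (sqrt (2 * pi) / \<sigma>) / of_real (2 * pi) = complex_of_real (1 / (sqrt (2 * pi) * \<sigma>))"
  proof -
    have "sqrt (2 * pi) / \<sigma> / (2 * pi) = 1 / (sqrt (2 * pi) * \<sigma>)"
      using pos by (simp add: field_simps flip: power2_eq_square)
    thus ?thesis by (simp only: of_real_divide[symmetric])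
  qed
  finally show ?thesis .
qed

section \<open>Bounds on the circles and the two saddle points\<close>

text \<open>Termwise comparison of the exponential series; this is the form in which the
  nonnegativity of the Taylor coefficients is used.\<close>

lemma norm_exp_minus_1_le: "norm (exp z - 1) \<le> exp (norm z) - 1" for z :: complex
proof -
  have "(\<lambda>n. z ^ Suc n /\<^sub>R fact (Suc n)) sums (exp z - 1)"
    using sums_split_initial_segment[OF exp_converges[of z], of 1] by simp
  moreover have "(\<lambda>n. norm z ^ Suc n /\<^sub>R fact (Suc n)) sums (exp (norm z) - 1)"
    using sums_split_initial_segment[OF exp_converges[of "norm z"], of 1] by simp
  ultimately show ?thesis
    by (rule norm_sums_le) (simp add: norm_mult norm_power)
qed

text \<open>With \<open>y = \<bar>x\<bar> / 2 \<le> 2\<close> one has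
  \<open>sin y \<ge> y - y ^ 3 / 6 \<ge> y / 3\<close>, and
  \<open>1 - cos x = 2 * (sin y)\<^sup>2\<close>; this gives 1/18. Any positive constant would do
  for the domination.\<close>

lemma one_minus_cos_ge:
  fixes x :: real
  assumes "\<bar>x\<bar> \<le> pi"
  shows "x\<^sup>2 / 18 \<le> 1 - cos x"
proof -
  define y where "y = \<bar>x\<bar> / 2"
  have y: "0 \<le> y" "y \<le> 2" using assms pi_less_4 by (auto simp: y_def)
  have "\<bar>sin y - y\<bar> \<le> y ^ 3 / 6"
    using Maclaurin_sin_bound[of y 3] y
    by (simp add: numeral_3_eq_3 sin_coeff_def fact_numeral)
  moreover have "y ^ 3 \<le> 4 * y"
  proof -
    have "y * (y * y) \<le> y * (2 * 2)" using y by (intro mult_mono) auto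
    thus ?thesis by (simp add: power3_eq_cube mult_ac)
  qed
  ultimately have "y / 3 \<le> sin y" by linarith
  hence "(y / 3)\<^sup>2 \<le> (sin y)\<^sup>2" using y by (intro power_mono) auto
  moreover have "cos x = 1 - 2 * (sin y)\<^sup>2"
    using cos_double_sin[of y] by (simp add: y_def)
  ultimately show ?thesis by (simp add: y_def power_divide)
qed

lemma linear_coeff_limit:
  "(\<lambda>n. of_real (sqrt n * (1/2) ^ (n - 1)) * exp (- (of_nat n * (2 * of_real (1/2)))) *
         fexp (of_nat n * (2 * fps_X)) $ (n - 1))
     \<longlonglongrightarrow> complex_of_real (1 / (sqrt (2 * pi) * 1))"
proof (rule saddle_point_coeff_limit[where h = "\<lambda>z. 2 * z" and h' = "\<lambda>_. 2" and h'' = "\<lambda>_. 0" and lam = "1/2" and \<sigma> = 1 and c = "1/18"])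
    fix x :: real assume "\<bar>x\<bar> \<le> pi"
    from one_minus_cos_ge[OF this]
    show "Re (2 * (complex_of_real (1/2) * cis x)) \<le> Re (2 * complex_of_real (1/2)) - 1/18 * x\<^sup>2"
      by simp
  next
    fix n
    show "(\<lambda>z. exp (of_nat n * (2 * z))) has_fps_expansion fexp (of_nat n * (2 * fps_X) :: complex fps)"
      unfolding fexp_def
      by (rule has_fps_expansion_exp_compose)
         (auto intro!: fps_expansion_intros simp: numeral_fps_const simp flip: fps_of_nat)
qed (auto intro!: derivative_eq_intros)

text \<open>All data at the saddle point follow from \<open>2 * \<mu> * exp \<mu> = 1\<close>: the
  value of \<open>h\<close> is \<open>1 - \<mu>\<close>, and
  \<open>1 + \<mu>\<^sup>2 * h'' \<mu> = 1 + \<mu> * (2 + \<mu>)\<close> is the square of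
  \<open>1 + \<mu>\<close>.\<close>

lemma tree_coeff_limit:
  fixes \<mu> :: real
  assumes \<mu>: "2 * \<mu> = exp (- \<mu>)"
  shows "(\<lambda>n. of_real (sqrt n * \<mu> ^ (n - 1)) * exp (- (of_nat n * of_real (1 - \<mu>))) *
              fexp (of_nat n * (2 * (fps_X * fexp fps_X) - fps_X)) $ (n - 1))
     \<longlonglongrightarrow> complex_of_real (1 / (sqrt (2 * pi) * (1 + \<mu>)))"
proof -
  have pos: "\<mu> > 0" using \<mu> exp_gt_zero[of "-\<mu>"] by linarith
  have e: "2 * \<mu> * exp \<mu> = 1" using \<mu> by (simp add: exp_minus)
  have ec: "2 * of_real \<mu> * exp (of_real \<mu>) = (1::complex)"
    using arg_cong[OF e, of complex_of_real] by (simp add: exp_of_real)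
  let ?h = "\<lambda>z::complex. 2 * (z * exp z) - z"
  have "(\<lambda>n. of_real (sqrt n * \<mu> ^ (n - 1)) * exp (- (of_nat n * ?h (of_real \<mu>))) *
              fexp (of_nat n * (2 * (fps_X * fexp fps_X) - fps_X)) $ (n - 1))
     \<longlonglongrightarrow> complex_of_real (1 / (sqrt (2 * pi) * (1 + \<mu>)))"
  proof (rule saddle_point_coeff_limit[where h = ?h and h' = "\<lambda>z. 2 * (1 + z) * exp z - 1" and h'' = "\<lambda>z. 2 * (2 + z) * exp z" and c = "\<mu> / 18"])
    show "of_real \<mu> * (2 * (1 + of_real \<mu>) * exp (of_real \<mu>) - 1) = (1::complex)"
      using ec by (simp add: algebra_simps)
    have "1 + (of_real \<mu>)\<^sup>2 * (2 * (2 + of_real \<mu>) * exp (of_real \<mu>)) =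
            1 + of_real \<mu> * (2 + of_real \<mu>) * (2 * of_real \<mu> * exp (of_real \<mu>) :: complex)"
      by (simp add: power2_eq_square mult_ac)
    thus "1 + complex_of_real (\<mu>\<^sup>2) * (2 * (2 + of_real \<mu>) * exp (of_real \<mu>)) = of_real ((1 + \<mu>)\<^sup>2)"
      unfolding ec by (simp add: power2_eq_square algebra_simps)
  next
    fix x :: real assume x: "\<bar>x\<bar> \<le> pi"
    let ?w = "of_real \<mu> * cis x :: complex"
    \<comment> \<open>Write \<open>h(w) = 2 w (e^w - 1) + w\<close>. The first summand is at most
      its value at \<open>\<mu>\<close>; the quadratic loss comes from the real part
      \<open>\<mu> * cos x\<close> of the second alone.\<close>
    have "Re (?w * (exp ?w - 1)) \<le> norm (?w * (exp ?w - 1))"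
      by (rule complex_Re_le_cmod)
    also have "\<dots> \<le> \<mu> * (exp \<mu> - 1)"
      using norm_exp_minus_1_le[of ?w] pos by (simp add: norm_mult)
    finally have "Re (?w * (exp ?w - 1)) \<le> \<mu> * (exp \<mu> - 1)" .
    moreover have "Re (?h ?w) = 2 * Re (?w * (exp ?w - 1)) + \<mu> * cos x"
      by (simp add: algebra_simps)
    moreover have "\<mu> * (x\<^sup>2 / 18) \<le> \<mu> * (1 - cos x)"
      using one_minus_cos_ge[OF x] pos by (intro mult_left_mono) auto
    moreover have "Re (?h (of_real \<mu>)) = 2 * (\<mu> * exp \<mu>) - \<mu>"
      by (simp add: exp_of_real)
    ultimately show "Re (?h ?w) \<le> Re (?h (of_real \<mu>)) - \<mu> / 18 * x\<^sup>2"
      by (simp only:) (simp add: right_diff_distrib)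
  next
    fix n
    show "(\<lambda>z. exp (of_nat n * ?h z)) has_fps_expansion fexp (of_nat n * (2 * (fps_X * fexp fps_X) - fps_X) :: complex fps)"
      unfolding fexp_def
      by (rule has_fps_expansion_exp_compose)
         (auto intro!: fps_expansion_intros simp: numeral_fps_const simp flip: fps_of_nat)
  next
    fix z
    show "(?h has_field_derivative 2 * (1 + z) * exp z - 1) (at z)"
      by (rule derivative_eq_intros refl | simp add: algebra_simps)+
    show "((\<lambda>z. 2 * (1 + z) * exp z - 1) has_field_derivative 2 * (2 + z) * exp z) (at z)"
      by (rule derivative_eq_intros refl | simp add: algebra_simps)+
  qed (use pos in auto)
  moreover have "?h (of_real \<mu>) = of_real (1 - \<mu>)"
    using ec by (simp add: algebra_simps)
  ultimately show ?thesis by (simp only: )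
qed

lemma coeff_recurrence_ratio_limit:
  fixes t r :: "nat \<Rightarrow> real" and \<mu> :: real
  assumes rec: "coeff_recurrence t r" and \<mu>: "2 * \<mu> = exp (- \<mu>)"
  shows "(\<lambda>n. r n / t n) \<longlonglongrightarrow> 2 * \<mu> / (1 + \<mu>)"
proof -
  have pos: "\<mu> > 0" using \<mu> exp_gt_zero[of "-\<mu>"] by linarith
  \<comment> \<open>The saddle point limits concern complex coefficients, so the recurrence is
    transferred to them.\<close>
  have rec': "coeff_recurrence (\<lambda>n. complex_of_real (t n)) (\<lambda>n. complex_of_real (r n))"
    unfolding coeff_recurrence_def
  proof (intro conjI allI impI)
    fix n :: nat assume n: "n \<ge> 2"
    have "(of_nat n - 1) * complex_of_real (t n) = of_real ((real n - 1) * t n)" by simp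
    also have "\<dots> = of_real (\<Sum>k=1..n-1. t k * (real (n - k) * (2 * t (n - k))))"
      using rec n by (simp only: coeff_recurrence_def)
    finally show "(of_nat n - 1) * complex_of_real (t n) =
        (\<Sum>k=1..n-1. of_real (t k) * (of_nat (n - k) * (2 * of_real (t (n - k)))))"
      by simp
    have "(of_nat n - 1) * complex_of_real (r n) = of_real ((real n - 1) * r n)" by simp
    also have "\<dots> = of_real (\<Sum>k=1..n-1. r k * (real (n - k) * (2 * t (n - k) - r (n - k))))"
      using rec n by (simp only: coeff_recurrence_def)
    finally show "(of_nat n - 1) * complex_of_real (r n) =
        (\<Sum>k=1..n-1. of_real (r k) * (of_nat (n - k) * (2 * of_real (t (n - k)) - of_real (r (n - k)))))"
      by simp
  qed (use rec in \<open>auto simp: coeff_recurrence_def\<close>)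
  define A B where "A = (\<lambda>n. sqrt n * (1/2::real) ^ (n - 1) * exp (- (real n * (2 * (1/2)))) * (real n * t n))"
    and "B = (\<lambda>n. sqrt n * \<mu> ^ (n - 1) * exp (- (real n * (1 - \<mu>))) * (real n * r n))"
  have "(\<lambda>n. complex_of_real (A n)) \<longlonglongrightarrow> of_real (1 / (sqrt (2 * pi) * 1))"
    by (rule Lim_transform_eventually[OF linear_coeff_limit])
       (use coeff_recurrence_solution(2)[OF rec'] in
        \<open>auto simp: A_def eventually_at_top_linorder simp flip: exp_of_real intro!: exI[of _ 1]\<close>)
  hence A: "A \<longlonglongrightarrow> 1 / (sqrt (2 * pi) * 1)" by (simp only: tendsto_of_real_iff)
  have "(\<lambda>n. complex_of_real (B n)) \<longlonglongrightarrow> of_real (1 / (sqrt (2 * pi) * (1 + \<mu>)))"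
    by (rule Lim_transform_eventually[OF tree_coeff_limit[OF \<mu>]])
       (use coeff_recurrence_solution(3)[OF rec'] in
        \<open>auto simp: B_def eventually_at_top_linorder simp flip: exp_of_real intro!: exI[of _ 1]\<close>)
  hence B: "B \<longlonglongrightarrow> 1 / (sqrt (2 * pi) * (1 + \<mu>))" by (simp only: tendsto_of_real_iff)
  have "(\<lambda>n. 2 * \<mu> * (B n / A n)) \<longlonglongrightarrow> 2 * \<mu> * ((1 / (sqrt (2 * pi) * (1 + \<mu>))) / (1 / (sqrt (2 * pi) * 1)))"
    by (intro tendsto_intros A B) auto
  also have "2 * \<mu> * ((1 / (sqrt (2 * pi) * (1 + \<mu>))) / (1 / (sqrt (2 * pi) * 1))) = 2 * \<mu> / (1 + \<mu>)"
  proof -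
    have "2 * \<mu> * ((1 / (s * (1 + \<mu>))) / (1 / (s * 1))) = 2 * \<mu> / (1 + \<mu>)" if "s \<noteq> 0" for s :: real
      using that by simp
    thus ?thesis by simp
  qed
  finally show ?thesis
  proof (rule Lim_transform_eventually)
    show "\<forall>\<^sub>F n in sequentially. 2 * \<mu> * (B n / A n) = r n / t n"
      using eventually_gt_at_top[of 0]
    proof eventually_elim
      case (elim n)
      \<comment> \<open>The normalising factors of \<open>A\<close> and \<open>B\<close> differ
        exactly by \<open>2 * \<mu>\<close>: the exponential parts agree because
        \<open>\<mu> * exp \<mu> = 1 / 2\<close>, and the exponent \<open>n - 1\<close> leaves the
        quotient of the radii.\<close>
      have "\<mu> ^ n * exp (real n * \<mu>) = (\<mu> * exp \<mu>) ^ n"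
        by (simp add: power_mult_distrib exp_of_nat_mult)
      also have "\<mu> * exp \<mu> = 1 / 2" using \<mu> by (simp add: exp_minus field_simps)
      finally have e: "\<mu> ^ n * exp (real n * \<mu>) = (1/2) ^ n" .
      have "2 * \<mu> * (sqrt n * \<mu> ^ (n - 1) * exp (- (real n * (1 - \<mu>)))) = 2 * sqrt n * (\<mu> ^ n * exp (real n * \<mu>)) * exp (- real n)"
        using elim by (simp add: power_eq_if exp_diff exp_minus field_simps)
      also have "\<dots> = sqrt n * (1/2) ^ (n - 1) * exp (- (real n * (2 * (1/2))))"
        unfolding e using elim by (simp add: power_eq_if)
      finally have "2 * \<mu> * B n = sqrt n * (1/2) ^ (n - 1) * exp (- (real n * (2 * (1/2)))) * (real n * r n)"
        unfolding B_def by (simp only: mult.assoc[symmetric])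
      hence "2 * \<mu> * B n / A n = r n / t n"
        using elim by (simp add: A_def)
      thus ?case by simp
    qed
  qed
qed

section \<open>Cutting trees at the root\<close>

text \<open>Connectedness in the underlying undirected graph, for a bare arc set, so that deleting
  an arc is plain set difference.\<close>

definition conn :: "('a \<times> 'a) set \<Rightarrow> ('a \<times> 'a) set" where
  "conn E = (E \<union> E\<inverse>)\<^sup>*"

lemma conn_refl [simp]: "(x, x) \<in> conn E"
  by (simp add: conn_def)

lemma conn_sym: "(x, y) \<in> conn E \<Longrightarrow> (y, x) \<in> conn E"
  unfolding conn_def by (meson sym_Un_converse sym_rtrancl symD)

lemma conn_trans: "(x, y) \<in> conn E \<Longrightarrow> (y, z) \<in> conn E \<Longrightarrow> (x, z) \<in> conn E"
  unfolding conn_def by (rule rtrancl_trans)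

lemma conn_arc: "(x, y) \<in> E \<Longrightarrow> (x, y) \<in> conn E"
  unfolding conn_def by auto

lemma conn_mono: "(x, y) \<in> conn E \<Longrightarrow> E \<subseteq> E' \<Longrightarrow> (x, y) \<in> conn E'"
  unfolding conn_def by (meson Un_mono converse_mono rtrancl_mono subsetD)

lemma conn_induct [consumes 1, case_names refl step]:
  assumes "(x, y) \<in> conn E" "P x"
    "\<And>y z. (x, y) \<in> conn E \<Longrightarrow> (y, z) \<in> E \<or> (z, y) \<in> E \<Longrightarrow> P y \<Longrightarrow> P z"
  shows "P y"
  using assms(1) unfolding conn_def
  by (induction rule: rtrancl_induct) (use assms(2,3) in \<open>auto simp: conn_def\<close>)

text \<open>A walk may be shortened so that it crosses the new edge at most once, in one of its two
  directions.\<close>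

lemma conn_insert:
  assumes "(x, y) \<in> conn (insert (a, b) E)"
  shows "(x, y) \<in> conn E \<or> (x, a) \<in> conn E \<and> (b, y) \<in> conn E \<or> (x, b) \<in> conn E \<and> (a, y) \<in> conn E"
  using assms
proof (induction rule: conn_induct)
  case (step y z)
  then consider "(y, z) \<in> conn E" | "y = a" "z = b" | "y = b" "z = a"
    using conn_arc conn_sym by fast
  thus ?case
  proof cases
    case 1
    thus ?thesis using step.IH conn_trans[OF _ 1] by blast
  next
    case 2
    thus ?thesis using step.IH by auto
  next
    case 3
    thus ?thesis using step.IH by auto
  qed
qed auto

lemma conn_restrict:
  assumes "(x, y) \<in> conn (A \<union> B)" "x \<in> V" "A \<subseteq> V \<times> V" "B \<subseteq> W \<times> W" "V \<inter> W = {}"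
  shows "y \<in> V \<and> (x, y) \<in> conn A"
  using assms(1)
proof (induction rule: conn_induct)
  case (step y z)
  hence "z \<in> V" "(y, z) \<in> A \<or> (z, y) \<in> A" using assms by auto
  thus ?case using step.IH by (meson conn_arc conn_sym conn_trans)
qed (use assms in auto)

text \<open>
  A connected digraph all of whose arcs are bridges.  The bridge condition also excludes loops and
  pairs of opposite arcs.
\<close>
definition arc_tree :: "'a set \<Rightarrow> ('a \<times> 'a) set \<Rightarrow> bool" where
  "arc_tree V E \<longleftrightarrow> finite V \<and> V \<noteq> {} \<and> E \<subseteq> V \<times> V \<and>
     (\<forall>x\<in>V. \<forall>y\<in>V. (x, y) \<in> conn E) \<and> (\<forall>e\<in>E. e \<notin> conn (E - {e}))"

text \<open>The new arc is a bridge because it is the only link between the parts. An old arc stays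
  a bridge: a detour around it through the other part would have to cross the new arc, and there is
  no second way back.\<close>

lemma arc_tree_join:
  assumes T1: "arc_tree V1 E1" and T2: "arc_tree V2 E2" and disj: "V1 \<inter> V2 = {}"
    and r: "r \<in> V1" and c: "c \<in> V2" and e: "e = (r, c) \<or> e = (c, r)"
  shows "arc_tree (V1 \<union> V2) (insert e (E1 \<union> E2))"
proof -
  have sub: "E1 \<subseteq> V1 \<times> V1" "E2 \<subseteq> V2 \<times> V2" using T1 T2 by (auto simp: arc_tree_def)
  have eE: "e \<notin> E1 \<union> E2" using sub e r c disj by auto
  \<comment> \<open>Stated for abstract parts, since it is applied once with \<open>E1\<close> and
    once with \<open>E2\<close> as the part containing \<open>f\<close>.\<close>
  have bridge: "f \<notin> conn (insert e (A \<union> B) - {f})"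
    if A: "A \<subseteq> VA \<times> VA" and B: "B \<subseteq> VB \<times> VB" and disj: "VA \<inter> VB = {}" and f: "f \<in> A" and brA: "f \<notin> conn (A - {f})"
      and ab: "a \<in> VA" "b \<in> VB" "e = (a, b) \<or> e = (b, a)" for f A B VA VB a b
  proof
    obtain u v where uv: "f = (u, v)" by (cases f)
    assume "f \<in> conn (insert e (A \<union> B) - {f})"
    moreover have "insert e (A \<union> B) - {f} = insert e ((A - {f}) \<union> B)"
      using A B disj f ab by auto
    ultimately have "(u, v) \<in> conn (insert e ((A - {f}) \<union> B))" using uv by simp
    hence "(u, v) \<in> conn ((A - {f}) \<union> B) \<or> (b, v) \<in> conn ((A - {f}) \<union> B) \<or> (b, u) \<in> conn ((A - {f}) \<union> B)"
      using conn_insert[of u v a b] conn_insert[of u v b a] ab(3) conn_sym by metis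
    moreover have "w \<in> VA \<Longrightarrow> (b, w) \<notin> conn ((A - {f}) \<union> B)" for w
      using conn_restrict[of b w B "A - {f}" VB VA] A B disj ab by (auto simp: Un_commute)
    moreover have "u \<in> VA" "v \<in> VA" using f uv A by auto
    ultimately have "(u, v) \<in> conn ((A - {f}) \<union> B)" by blast
    hence "(u, v) \<in> conn (A - {f})"
      using conn_restrict[of u v "A - {f}" B VA VB] A B disj \<open>u \<in> VA\<close> by auto
    thus False using brA uv by simp
  qed
  have e_bridge: "e \<notin> conn (insert e (E1 \<union> E2) - {e})"
  proof
    assume "e \<in> conn (insert e (E1 \<union> E2) - {e})"
    hence "(r, c) \<in> conn (E1 \<union> E2)" using e eE conn_sym[of c r] by auto
    from conn_restrict[OF this r sub disj] show False using c disj by auto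
  qed
  let ?E = "insert e (E1 \<union> E2)"
  have toR: "(x, r) \<in> conn ?E" if x: "x \<in> V1 \<union> V2" for x
  proof (cases "x \<in> V1")
    case True
    hence "(x, r) \<in> conn E1" using T1 r by (auto simp: arc_tree_def)
    thus ?thesis by (rule conn_mono) auto
  next
    case False
    hence "(x, c) \<in> conn E2" using T2 c x by (auto simp: arc_tree_def)
    hence "(x, c) \<in> conn ?E" by (rule conn_mono) auto
    moreover have "(c, r) \<in> conn ?E" using e conn_arc[of c r ?E] conn_sym[OF conn_arc[of r c ?E]] by auto
    ultimately show ?thesis by (rule conn_trans)
  qed
  show ?thesis unfolding arc_tree_def
  proof (intro conjI ballI)
    fix x y assume "x \<in> V1 \<union> V2" "y \<in> V1 \<union> V2"
    thus "(x, y) \<in> conn ?E" using conn_trans[OF toR conn_sym[OF toR]] by blast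
  next
    fix f assume f: "f \<in> ?E"
    then consider "f = e" | "f \<in> E1" | "f \<in> E2" by blast
    thus "f \<notin> conn (?E - {f})"
    proof cases
      case 1
      thus ?thesis using e_bridge by simp
    next
      case 2
      show ?thesis
        by (rule bridge[of E1 V1 E2 V2 f r c]) (use sub disj 2 T1 r c e in \<open>auto simp: arc_tree_def\<close>)
    next
      case 3
      have "f \<notin> conn (insert e (E2 \<union> E1) - {f})"
        by (rule bridge[of E2 V2 E1 V1 f c r]) (use sub disj 3 T2 r c e in \<open>auto simp: arc_tree_def\<close>)
      thus ?thesis by (simp add: Un_commute)
    qed
  qed (use T1 T2 sub r c e in \<open>auto simp: arc_tree_def\<close>)
qed

text \<open>Induction along a walk from \<open>r\<close>: whenever it leaves \<open>r\<close>, the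
  arc it takes becomes \<open>e\<close>. An arc between two vertices other than \<open>r\<close>
  differs from \<open>e\<close> and so prolongs the connection from \<open>c\<close>.\<close>

lemma separating_arc_exists:
  assumes "(r, v) \<in> conn E" "v \<noteq> r"
  shows "\<exists>c. \<exists>e\<in>E. (e = (r, c) \<or> e = (c, r)) \<and> (c, v) \<in> conn (E - {e})"
proof -
  have "v \<noteq> r \<longrightarrow> (\<exists>c. \<exists>e\<in>E. (e = (r, c) \<or> e = (c, r)) \<and> (c, v) \<in> conn (E - {e}))"
    using assms(1)
  proof (induction rule: conn_induct)
    case (step y z)
    show ?case
    proof
      assume z: "z \<noteq> r"
      obtain f where f: "f \<in> E" "f = (y, z) \<or> f = (z, y)" using step.hyps by blast
      show "\<exists>c. \<exists>e\<in>E. (e = (r, c) \<or> e = (c, r)) \<and> (c, z) \<in> conn (E - {e})"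
      proof (cases "y = r")
        case True
        thus ?thesis using f by (intro exI[of _ z] bexI[of _ f]) auto
      next
        case False
        then obtain c e where ce: "e \<in> E" "e = (r, c) \<or> e = (c, r)" "(c, y) \<in> conn (E - {e})"
          using step.IH by blast
        have "f \<noteq> e" using f ce(2) False z by auto
        hence "(y, z) \<in> conn (E - {e})" using f by (metis DiffI conn_arc conn_sym singletonD)
        from conn_trans[OF ce(3) this] show ?thesis using ce(1,2) by blast
      qed
    qed
  qed simp
  thus ?thesis using assms(2) by blast
qed

text \<open>The converse of \<open>arc_tree_join\<close>. As \<open>e\<close> is a bridge, the
  components of its ends without \<open>e\<close> are disjoint; as a walk need cross
  \<open>e\<close> at most once, they cover \<open>V\<close>.\<close>

lemma arc_tree_split:
  assumes T: "arc_tree V E" and e: "e \<in> E" "e = (r, c) \<or> e = (c, r)"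
  defines "V1 \<equiv> {x \<in> V. (r, x) \<in> conn (E - {e})}" and "V2 \<equiv> {x \<in> V. (c, x) \<in> conn (E - {e})}"
  shows "V1 \<union> V2 = V" "V1 \<inter> V2 = {}" "r \<in> V1" "c \<in> V2"
    "arc_tree V1 (E \<inter> V1 \<times> V1)" "arc_tree V2 (E \<inter> V2 \<times> V2)"
    "E = insert e ((E \<inter> V1 \<times> V1) \<union> (E \<inter> V2 \<times> V2))"
proof -
  have sub: "E \<subseteq> V \<times> V" and con: "\<And>x y. x \<in> V \<Longrightarrow> y \<in> V \<Longrightarrow> (x, y) \<in> conn E"
    and br: "\<And>f. f \<in> E \<Longrightarrow> f \<notin> conn (E - {f})" and fin: "finite V"
    using T by (auto simp: arc_tree_def)
  have rc: "r \<in> V" "c \<in> V" using e sub by auto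
  show r1: "r \<in> V1" and c2: "c \<in> V2" using rc by (auto simp: V1_def V2_def)
  have nrc: "(r, c) \<notin> conn (E - {e})" using br[OF e(1)] e(2) conn_sym[of r c] by auto
  show disj: "V1 \<inter> V2 = {}"
  proof -
    have False if "(r, x) \<in> conn (E - {e})" "(c, x) \<in> conn (E - {e})" for x
      using conn_trans[OF that(1) conn_sym[OF that(2)]] nrc by blast
    thus ?thesis by (auto simp: V1_def V2_def)
  qed
  have ins: "insert e (E - {e}) = E" using e by auto
  show un: "V1 \<union> V2 = V"
  proof -
    have "x \<in> V1 \<union> V2" if x: "x \<in> V" for x
    proof -
      have "(r, x) \<in> conn (insert e (E - {e}))" using con[OF rc(1) x] ins by simp
      hence "(r, x) \<in> conn (E - {e}) \<or> (c, x) \<in> conn (E - {e})"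
        using conn_insert[of r x r c "E - {e}"] conn_insert[of r x c r "E - {e}"] e(2) nrc by auto
      thus ?thesis using x by (auto simp: V1_def V2_def)
    qed
    thus ?thesis by (auto simp: V1_def V2_def)
  qed
  have *: "E - {e} = (E \<inter> V1 \<times> V1) \<union> (E \<inter> V2 \<times> V2)"
  proof -
    have "f \<in> V1 \<times> V1 \<union> V2 \<times> V2" if f: "f \<in> E - {e}" for f
    proof -
      obtain u v where uv: "f = (u, v)" by (cases f)
      have "u \<in> V" "v \<in> V" using f sub uv by auto
      moreover have "(u, v) \<in> conn (E - {e})" using f uv conn_arc[of u v "E - {e}"] by simp
      moreover have "u \<in> V1 \<or> u \<in> V2" using \<open>u \<in> V\<close> un by blast
      ultimately have "u \<in> V1 \<and> v \<in> V1 \<or> u \<in> V2 \<and> v \<in> V2"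
        using conn_trans[of r u "E - {e}" v] conn_trans[of c u "E - {e}" v]
        unfolding V1_def V2_def by blast
      thus ?thesis using uv by blast
    qed
    moreover have "e \<notin> V1 \<times> V1" "e \<notin> V2 \<times> V2" using e(2) r1 c2 disj by auto
    ultimately show ?thesis by blast
  qed
  show "E = insert e ((E \<inter> V1 \<times> V1) \<union> (E \<inter> V2 \<times> V2))" using ins by (simp flip: *)
  have part: "arc_tree W (E \<inter> W \<times> W)"
    if W: "E - {e} = (E \<inter> W \<times> W) \<union> (E \<inter> W' \<times> W')" "W \<inter> W' = {}" "W \<subseteq> V" "W \<noteq> {}"
      and conW: "\<And>x y. x \<in> W \<Longrightarrow> y \<in> W \<Longrightarrow> (x, y) \<in> conn (E - {e})" for W W'
    unfolding arc_tree_def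
  proof (intro conjI ballI)
    fix x y assume xy: "x \<in> W" "y \<in> W"
    from conn_restrict[OF conW[OF xy, unfolded W(1)] xy(1), of W'] W(2)
    show "(x, y) \<in> conn (E \<inter> W \<times> W)" by auto
  next
    fix f assume "f \<in> E \<inter> W \<times> W"
    moreover have "E \<inter> W \<times> W - {f} \<subseteq> E - {f}" by auto
    ultimately show "f \<notin> conn (E \<inter> W \<times> W - {f})"
      using br[of f] conn_mono[of "fst f" "snd f" "E \<inter> W \<times> W - {f}" "E - {f}"] by auto
  qed (use W finite_subset[OF W(3) fin] in auto)
  have link: "(x, y) \<in> conn (E - {e})" if "(z, x) \<in> conn (E - {e})" "(z, y) \<in> conn (E - {e})" for x y z
    using that by (rule conn_trans[OF conn_sym])
  show "arc_tree V1 (E \<inter> V1 \<times> V1)"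
  proof (rule part[OF * disj])
    show "V1 \<subseteq> V" "V1 \<noteq> {}" using un r1 by auto
    show "(x, y) \<in> conn (E - {e})" if "x \<in> V1" "y \<in> V1" for x y
      using that unfolding V1_def by (blast intro: link)
  qed
  show "arc_tree V2 (E \<inter> V2 \<times> V2)"
  proof (rule part)
    show "E - {e} = (E \<inter> V2 \<times> V2) \<union> (E \<inter> V1 \<times> V1)" unfolding * by (rule Un_commute)
    show "V2 \<inter> V1 = {}" using disj by (simp add: Int_commute)
    show "V2 \<subseteq> V" "V2 \<noteq> {}" using un c2 by auto
    show "(x, y) \<in> conn (E - {e})" if "x \<in> V2" "y \<in> V2" for x y
      using that unfolding V2_def by (blast intro: link)
  qed
qed

section \<open>Positions lost for the player to move\<close>

text \<open>Each move has a reply that leads to a lost position again. Going two moves at a time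
  keeps \<open>lost\<close> in positive position; "no successor is lost" would not be a monotone
  rule.\<close>

inductive lost :: "('a \<times> 'a) set \<Rightarrow> 'a \<Rightarrow> bool" for E where
  lostI: "(\<And>w. (v, w) \<in> E \<Longrightarrow> \<exists>u. (w, u) \<in> E \<and> lost E u) \<Longrightarrow> lost E v"

text \<open>Without infinite plays there are no draws, so the position after a move is won as soon
  as it is not lost. This is the recursion that characterises kernels.\<close>

lemma lost_iff:
  assumes "wf (E\<inverse>)"
  shows "lost E v \<longleftrightarrow> (\<forall>w. (v, w) \<in> E \<longrightarrow> \<not> lost E w)"
  using assms
proof (induction v rule: wf_induct_rule)
  case (less v)
  hence "lost E w \<longleftrightarrow> (\<forall>u. (w, u) \<in> E \<longrightarrow> \<not> lost E u)" if "(v, w) \<in> E" for w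
    using that by blast
  thus ?case by (subst lost.simps) blast
qed

text \<open>The status of a position depends only on what is reachable from it; \<open>S\<close> is
  any set closed under moves on which the two arc sets agree.\<close>

lemma lost_local:
  assumes wf: "wf (E\<inverse>)" "wf (E'\<inverse>)"
    and S: "\<And>v w. v \<in> S \<Longrightarrow> (v, w) \<in> E \<Longrightarrow> w \<in> S"
    and eq: "\<And>v w. v \<in> S \<Longrightarrow> (v, w) \<in> E \<longleftrightarrow> (v, w) \<in> E'"
    and v: "v \<in> S"
  shows "lost E v \<longleftrightarrow> lost E' v"
  using wf(1) v
proof (induction v rule: wf_induct_rule)
  case (less v)
  have "lost E w \<longleftrightarrow> lost E' w" if "(v, w) \<in> E" for w
    using less.IH[of w] S[OF less.prems that] that by simp
  thus ?case using lost_iff[OF wf(1), of v] lost_iff[OF wf(2), of v] eq[OF less.prems] by blast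
qed

lemma rtrancl_avoid_target: "(y, x) \<in> E\<^sup>* \<Longrightarrow> (y, x) \<in> (E - {x} \<times> UNIV)\<^sup>*"
proof (induction rule: converse_rtrancl_induct)
  case (step y z)
  show ?case
  proof (cases "y = x")
    case False
    hence "(y, z) \<in> E - {x} \<times> UNIV" using step by auto
    thus ?thesis using step.IH by (rule converse_rtrancl_into_rtrancl)
  qed simp
qed simp

text \<open>A directed cycle through \<open>(x, y)\<close> leads from \<open>y\<close> back to
  \<open>x\<close>. Stopped at its first visit to \<open>x\<close> it uses no arc out of
  \<open>x\<close>, so \<open>(x, y)\<close> would not be a bridge.\<close>

lemma arc_tree_wf:
  assumes T: "arc_tree V E"
  shows "wf (E\<inverse>)"
proof (rule finite_acyclic_wf_converse)
  show "finite E" using T finite_subset[of E "V \<times> V"] by (auto simp: arc_tree_def)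
  show "acyclic E"
  proof (rule acyclicI, intro allI notI)
    fix x assume "(x, x) \<in> E\<^sup>+"
    then obtain y where y: "(x, y) \<in> E" "(y, x) \<in> E\<^sup>*" by (meson tranclD)
    from rtrancl_avoid_target[OF y(2)] have "(y, x) \<in> conn (E - {(x, y)})"
      unfolding conn_def by (rule set_mp[OF rtrancl_mono, rotated]) auto
    hence "(x, y) \<in> conn (E - {(x, y)})" by (rule conn_sym)
    thus False using T y(1) by (auto simp: arc_tree_def)
  qed
qed

text \<open>An arc into \<open>r\<close> changes nothing that is reachable from \<open>r\<close>. An
  arc from \<open>r\<close> to \<open>c\<close> adds one option at \<open>r\<close>, which spoils a
  lost position exactly if \<open>c\<close> is lost.\<close>

lemma arc_tree_join_lost:
  assumes T1: "arc_tree V1 E1" and T2: "arc_tree V2 E2" and disj: "V1 \<inter> V2 = {}"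
    and r: "r \<in> V1" and c: "c \<in> V2"
  shows "lost (insert (c, r) (E1 \<union> E2)) r \<longleftrightarrow> lost E1 r"
    and "lost (insert (r, c) (E1 \<union> E2)) r \<longleftrightarrow> lost E1 r \<and> \<not> lost E2 c"
proof -
  have sub: "E1 \<subseteq> V1 \<times> V1" "E2 \<subseteq> V2 \<times> V2" using T1 T2 by (auto simp: arc_tree_def)
  note wf1 = arc_tree_wf[OF T1] and wf2 = arc_tree_wf[OF T2]
  have wf: "wf ((insert (c, r) (E1 \<union> E2))\<inverse>)" "wf ((insert (r, c) (E1 \<union> E2))\<inverse>)"
    using arc_tree_wf[OF arc_tree_join[OF T1 T2 disj r c]] by blast+
  show "lost (insert (c, r) (E1 \<union> E2)) r \<longleftrightarrow> lost E1 r"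
    by (rule lost_local[OF wf(1) wf1, of V1]) (use sub disj r c in auto)
  let ?E = "insert (r, c) (E1 \<union> E2)"
  have c': "lost ?E c \<longleftrightarrow> lost E2 c"
    by (rule lost_local[OF wf(2) wf2, of V2]) (use sub disj r c in auto)
  \<comment> \<open>The other successors of \<open>r\<close> keep their status: by acyclicity
    \<open>r\<close> is not reachable from them in \<open>E1\<close>, so the new arc is not
    either.\<close>
  have w': "lost ?E w \<longleftrightarrow> lost E1 w" if w: "(r, w) \<in> E1" for w
  proof -
    have "acyclic E1" using wf_acyclic[OF wf1] by (simp add: acyclic_converse)
    hence nr: "(w, r) \<notin> E1\<^sup>*" using w by (meson acyclic_def rtrancl_into_trancl2)
    have V1: "x \<in> V1" if "(w, x) \<in> E1\<^sup>*" for x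
      using that w sub by (induction) auto
    show ?thesis
    proof (rule lost_local[OF wf(2) wf1])
      show "w \<in> {x. (w, x) \<in> E1\<^sup>*}" by simp
      fix x y assume x: "x \<in> {x. (w, x) \<in> E1\<^sup>*}"
      hence "x \<noteq> r" "x \<in> V1" using nr V1 by auto
      thus eq: "(x, y) \<in> ?E \<longleftrightarrow> (x, y) \<in> E1" using sub disj by auto
      show "y \<in> {x. (w, x) \<in> E1\<^sup>*}" if "(x, y) \<in> ?E"
        using that x eq by (auto intro: rtrancl_into_rtrancl)
    qed
  qed
  have nbr: "(r, w) \<in> ?E \<longleftrightarrow> w = c \<or> (r, w) \<in> E1" for w using sub disj r by auto
  have "lost ?E r \<longleftrightarrow> (\<forall>w. (r, w) \<in> ?E \<longrightarrow> \<not> lost ?E w)" by (rule lost_iff[OF wf(2)])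
  also have "\<dots> \<longleftrightarrow> \<not> lost ?E c \<and> (\<forall>w. (r, w) \<in> E1 \<longrightarrow> \<not> lost ?E w)"
    unfolding nbr by blast
  also have "\<dots> \<longleftrightarrow> \<not> lost E2 c \<and> (\<forall>w. (r, w) \<in> E1 \<longrightarrow> \<not> lost E1 w)"
    using c' w' by (metis (no_types))
  also have "\<dots> \<longleftrightarrow> lost E1 r \<and> \<not> lost E2 c"
    using lost_iff[OF wf1, of r] by blast
  finally show "lost ?E r \<longleftrightarrow> lost E1 r \<and> \<not> lost E2 c" .
qed

section \<open>The grafting bijection\<close>

definition rooted :: "'a set \<Rightarrow> (('a \<times> 'a) set \<times> 'a) set" where
  "rooted V = {(E, r). arc_tree V E \<and> r \<in> V}"

definition lost_rooted :: "'a set \<Rightarrow> (('a \<times> 'a) set \<times> 'a) set" where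
  "lost_rooted V = {(E, r). arc_tree V E \<and> r \<in> V \<and> lost E r}"

lemma lost_rooted_subset: "lost_rooted V \<subseteq> rooted V"
  by (auto simp: rooted_def lost_rooted_def)

lemma finite_rooted: "finite V \<Longrightarrow> finite (rooted V)"
  by (rule finite_subset[of _ "Pow (V \<times> V) \<times> V"]) (auto simp: rooted_def arc_tree_def)

lemma finite_lost_rooted: "finite V \<Longrightarrow> finite (lost_rooted V)"
  by (rule finite_subset[OF lost_rooted_subset finite_rooted])

text \<open>
  The vertex $v$ of the second part is the marked one, and $d$ tells whether the new arc leads
  from the root $r$ to the root $c$ of the second part or back.
\<close>
fun graft :: "'a set \<times> (('a \<times> 'a) set \<times> 'a) \<times> (('a \<times> 'a) set \<times> 'a) \<times> 'a \<times> bool \<Rightarrow>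
    (('a \<times> 'a) set \<times> 'a) \<times> 'a" where
  "graft (V1, (E1, r), (E2, c), v, d) = ((insert (if d then (r, c) else (c, r)) (E1 \<union> E2), r), v)"

definition proper_parts :: "'a set \<Rightarrow> 'a set set" where
  "proper_parts V = {V1. V1 \<subseteq> V \<and> V1 \<noteq> {} \<and> V1 \<noteq> V}"

definition grafts :: "'a set \<Rightarrow> ('a set \<times> (('a \<times> 'a) set \<times> 'a) \<times> (('a \<times> 'a) set \<times> 'a) \<times> 'a \<times> bool) set" where
  "grafts V = (SIGMA V1 : proper_parts V. rooted V1 \<times> rooted (V - V1) \<times> (V - V1) \<times> UNIV)"

lemma graftsE:
  assumes "p \<in> grafts V"
  obtains V1 E1 r E2 c v d where "p = (V1, (E1, r), (E2, c), v, d)"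
    "arc_tree V1 E1" "arc_tree (V - V1) E2" "V1 \<subseteq> V" "r \<in> V1" "c \<in> V - V1" "v \<in> V - V1"
    "graft p = ((insert (if d then (r, c) else (c, r)) (E1 \<union> E2), r), v)"
    "arc_tree V (insert (if d then (r, c) else (c, r)) (E1 \<union> E2))"
proof -
  obtain V1 E1 r E2 c v d where p: "p = (V1, (E1, r), (E2, c), v, d)"
    by (metis prod.exhaust)
  have *: "arc_tree V1 E1" "arc_tree (V - V1) E2" "V1 \<subseteq> V" "r \<in> V1" "c \<in> V - V1" "v \<in> V - V1"
    using assms by (auto simp: p grafts_def proper_parts_def rooted_def)
  have "arc_tree (V1 \<union> (V - V1)) (insert (if d then (r, c) else (c, r)) (E1 \<union> E2))"
    by (rule arc_tree_join[OF *(1,2) _ *(4,5)]) auto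
  moreover have "V1 \<union> (V - V1) = V" using * by auto
  ultimately show ?thesis using p * by (intro that[of V1 E1 r E2 c v d]) auto
qed

text \<open>The arc added by grafting is recovered as the one at the root that separates it from
  \<open>v\<close>, and the first part as the component of the root once that arc is
  deleted.\<close>

lemma inj_on_graft: "inj_on graft (grafts V)"
proof (rule inj_onI)
  fix p p' assume "p \<in> grafts V" "p' \<in> grafts V" and eq: "graft p = graft p'"
  from \<open>p \<in> grafts V\<close> show "p = p'"
  proof (cases rule: graftsE)
    case p: (1 V1 E1 r E2 c v d)
    from \<open>p' \<in> grafts V\<close> show ?thesis
    proof (cases rule: graftsE)
      case p': (1 V1' E1' r' E2' c' v' d')
      define e e' where "e = (if d then (r, c) else (c, r))" and "e' = (if d' then (r, c') else (c', r))"
      have rv: "r' = r" "v' = v" and E: "insert e (E1 \<union> E2) = insert e' (E1' \<union> E2')"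
        using eq p p' by (auto simp: e_def e'_def)
      define E where "E = insert e (E1 \<union> E2)"
      have T: "arc_tree V E" using p by (simp add: E_def e_def)
      have sub: "E1 \<subseteq> V1 \<times> V1" "E2 \<subseteq> (V - V1) \<times> (V - V1)" "E1' \<subseteq> V1' \<times> V1'" "E2' \<subseteq> (V - V1') \<times> (V - V1')"
        using p p' by (auto simp: arc_tree_def)
      \<comment> \<open>Otherwise \<open>e'\<close>, being at \<open>r\<close>, lies in
        \<open>E1\<close>. Then \<open>r\<close> reaches \<open>c\<close> by \<open>e\<close>, next
        \<open>v\<close> inside \<open>E2\<close>, and finally \<open>c'\<close> inside
        \<open>E2'\<close>, all without \<open>e'\<close>, which therefore is no bridge.\<close>
      have "e' = e"
      proof (rule ccontr)
        assume ne: "e' \<noteq> e"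
        have "e' \<in> E" using E E_def by auto
        hence e'1: "e' \<in> E1" using ne sub p by (auto simp: E_def e'_def split: if_splits)
        hence "e' \<notin> E2" using sub by auto
        hence "(c, v) \<in> conn (E - {e'})"
          using p conn_mono[of c v E2 "E - {e'}"] by (auto simp: arc_tree_def E_def)
        moreover have "(v, c') \<in> conn (E - {e'})"
        proof -
          have "e' \<notin> E2'" using sub p' rv by (auto simp: e'_def split: if_splits)
          hence "E2' \<subseteq> E - {e'}" unfolding E_def E by auto
          thus ?thesis using p' rv conn_mono[of v c' E2' "E - {e'}"] by (auto simp: arc_tree_def)
        qed
        moreover have "(r, c) \<in> conn (E - {e'})"
          using ne conn_arc[of r c "E - {e'}"] conn_sym[OF conn_arc[of c r "E - {e'}"]]
          by (auto simp: E_def e_def split: if_splits)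
        ultimately have "(r, c') \<in> conn (E - {e'})" using conn_trans[of _ _ "E - {e'}"] by meson
        hence "e' \<in> conn (E - {e'})" using conn_sym[of r c'] by (auto simp: e'_def)
        thus False using T \<open>e' \<in> E\<close> by (auto simp: arc_tree_def)
      qed
      moreover have "r \<noteq> c" "r \<noteq> c'" using p p' rv by auto
      ultimately have cd: "c' = c" "d' = d" by (auto simp: e_def e'_def split: if_splits)
      have "e \<notin> E1 \<union> E2" "e \<notin> E1' \<union> E2'"
        using sub p p' rv cd by (auto simp: e_def)
      hence F: "E1 \<union> E2 = E1' \<union> E2'" using E \<open>e' = e\<close> by (metis insert_ident)
      have side: "x \<in> W \<longleftrightarrow> (r, x) \<in> conn (A \<union> B)"
        if "arc_tree W A" "B \<subseteq> (V - W) \<times> (V - W)" "r \<in> W" for W A B x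
      proof
        assume "x \<in> W"
        hence "(r, x) \<in> conn A" using that by (auto simp: arc_tree_def)
        thus "(r, x) \<in> conn (A \<union> B)" by (rule conn_mono) auto
      next
        assume "(r, x) \<in> conn (A \<union> B)"
        from conn_restrict[OF this that(3) _ that(2)] that(1)
        show "x \<in> W" by (auto simp: arc_tree_def)
      qed
      have r': "r \<in> V1'" using p'(5) rv by simp
      have "V1 = V1'"
      proof (rule set_eqI)
        fix x
        have "x \<in> V1 \<longleftrightarrow> (r, x) \<in> conn (E1 \<union> E2)" by (rule side[OF p(2) sub(2) p(5)])
        also have "\<dots> \<longleftrightarrow> x \<in> V1'" unfolding F by (rule side[OF p'(2) sub(4) r', symmetric])
        finally show "x \<in> V1 \<longleftrightarrow> x \<in> V1'" .
      qed
      moreover have "E1 = (E1 \<union> E2) \<inter> V1 \<times> V1" "E1' = (E1' \<union> E2') \<inter> V1' \<times> V1'"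
        "E2 = (E1 \<union> E2) - V1 \<times> V1" "E2' = (E1' \<union> E2') - V1' \<times> V1'"
        using sub by blast+
      ultimately have "E1 = E1'" "E2 = E2'" using F by metis+
      thus ?thesis using p(1) p'(1) rv cd \<open>V1 = V1'\<close> by simp
    qed
  qed
qed

text \<open>The range consists of the rooted trees with a marked vertex other than the root; the
  number of such marks is the factor \<open>n - 1\<close> of the recurrence.\<close>

lemma graft_image: "graft ` grafts V = (SIGMA p : rooted V. V - {snd p})"
proof (intro equalityI subsetI)
  fix q assume "q \<in> graft ` grafts V"
  then obtain p where "p \<in> grafts V" "q = graft p" by auto
  thus "q \<in> (SIGMA p : rooted V. V - {snd p})"
    by (auto elim!: graftsE simp: rooted_def)
next
  fix q assume "q \<in> (SIGMA p : rooted V. V - {snd p})"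
  moreover obtain E r v where q: "q = ((E, r), v)" by (metis prod.exhaust)
  ultimately have T: "arc_tree V E" and rv: "r \<in> V" "v \<in> V" "v \<noteq> r"
    by (simp_all add: rooted_def)
  have "(r, v) \<in> conn E" using T rv by (auto simp: arc_tree_def)
  from separating_arc_exists[OF this rv(3)]
  obtain c e where e: "e \<in> E" "e = (r, c) \<or> e = (c, r)" "(c, v) \<in> conn (E - {e})" by blast
  define V1 V2 where "V1 = {x \<in> V. (r, x) \<in> conn (E - {e})}" and "V2 = {x \<in> V. (c, x) \<in> conn (E - {e})}"
  note S = arc_tree_split[OF T e(1,2), folded V1_def V2_def]
  have V2: "V2 = V - V1" using S(1,2) by auto
  have vV2: "v \<in> V2" using e rv by (simp add: V2_def)
  define d where "d = (e = (r, c))"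
  let ?p = "(V1, (E \<inter> V1 \<times> V1, r), (E \<inter> V2 \<times> V2, c), v, d)"
  have "?p \<in> grafts V"
    using S vV2 unfolding V2 by (auto simp: grafts_def proper_parts_def rooted_def)
  moreover have "e = (if d then (r, c) else (c, r))" using e(2) by (auto simp: d_def)
  hence "graft ?p = q" using S(7) by (simp add: q)
  ultimately show "q \<in> graft ` grafts V" by (metis imageI)
qed

text \<open>By \<open>arc_tree_join_lost\<close> the root is lost iff it is lost in its own part and
  the new arc does not lead to a lost \<open>c\<close>. The subtracted product holds the forbidden
  choices, whence \<open>2 * a - b\<close> in place of \<open>2 * a\<close>.\<close>

lemma graft_lost_image:
  "graft ` (SIGMA V1 : proper_parts V. lost_rooted V1 \<times>
       (rooted (V - V1) \<times> (V - V1) \<times> UNIV - lost_rooted (V - V1) \<times> (V - V1) \<times> {True}))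
   = (SIGMA p : lost_rooted V. V - {snd p})" (is "graft ` ?D = ?R")
proof -
  have D: "p \<in> ?D \<longleftrightarrow> p \<in> grafts V \<and> lost (fst (fst (graft p))) (snd (fst (graft p)))" for p
  proof (cases "p \<in> grafts V")
    case True
    then show ?thesis
    proof (cases rule: graftsE)
      case p: (1 V1 E1 r E2 c v d)
      have disj: "V1 \<inter> (V - V1) = {}" by auto
      have "lost (insert (if d then (r, c) else (c, r)) (E1 \<union> E2)) r \<longleftrightarrow> lost E1 r \<and> \<not> (d \<and> lost E2 c)"
        using arc_tree_join_lost[OF p(2,3) disj p(5,6)] by auto
      hence "lost (fst (fst (graft p))) (snd (fst (graft p))) \<longleftrightarrow> lost E1 r \<and> \<not> (d \<and> lost E2 c)"
        unfolding p(8) by simp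
      thus ?thesis using True p(2-7) unfolding p(1) grafts_def
        by (auto simp: rooted_def lost_rooted_def)
    qed
  next
    case False
    thus ?thesis using lost_rooted_subset by (fastforce simp: grafts_def)
  qed
  have "graft ` ?D = {q \<in> graft ` grafts V. lost (fst (fst q)) (snd (fst q))}"
  proof -
    have "?D = {p \<in> grafts V. lost (fst (fst (graft p))) (snd (fst (graft p)))}"
      by (rule set_eqI) (simp only: D mem_Collect_eq)
    thus ?thesis by (simp only:) blast
  qed
  also have "\<dots> = ?R" unfolding graft_image by (auto simp: rooted_def lost_rooted_def)
  finally show ?thesis .
qed


section \<open>Recurrences for the numbers of trees\<close>

lemma card_rooted_step:
  assumes V: "finite V"
  shows "(card V - 1) * card (rooted V) =
    (\<Sum>V1\<in>proper_parts V. card (rooted V1) * (card (V - V1) * (2 * card (rooted (V - V1)))))"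
proof -
  have fin: "finite (proper_parts V)" using V by (simp add: proper_parts_def)
  have sub: "finite V1 \<and> finite (V - V1)" if "V1 \<in> proper_parts V" for V1
    using that V finite_subset by (auto simp: proper_parts_def)
  have "(\<Sum>p\<in>rooted V. card (V - {snd p})) = (\<Sum>p\<in>rooted V. card V - 1)"
    by (intro sum.cong refl) (use V in \<open>auto simp: rooted_def\<close>)
  hence "(card V - 1) * card (rooted V) = (\<Sum>p\<in>rooted V. card (V - {snd p}))"
    by simp
  also have "\<dots> = card (SIGMA p : rooted V. V - {snd p})"
    using V by (intro card_SigmaI[symmetric] finite_rooted) auto
  also have "\<dots> = card (grafts V)"
    unfolding graft_image[symmetric] by (rule card_image[OF inj_on_graft])
  also have "\<dots> = (\<Sum>V1\<in>proper_parts V. card (rooted V1 \<times> rooted (V - V1) \<times> (V - V1) \<times> (UNIV :: bool set)))"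
    unfolding grafts_def using sub fin V
    by (intro card_SigmaI) (auto intro!: finite_cartesian_product finite_rooted)
  finally show ?thesis by (simp add: card_cartesian_product mult_ac)
qed

lemma card_lost_rooted_step:
  assumes V: "finite V"
  shows "(card V - 1) * card (lost_rooted V) =
    (\<Sum>V1\<in>proper_parts V. card (lost_rooted V1) *
       (card (V - V1) * (2 * card (rooted (V - V1)) - card (lost_rooted (V - V1)))))"
proof -
  let ?Q = "\<lambda>V1. rooted (V - V1) \<times> (V - V1) \<times> (UNIV :: bool set) - lost_rooted (V - V1) \<times> (V - V1) \<times> {True}"
  let ?D = "SIGMA V1 : proper_parts V. lost_rooted V1 \<times> ?Q V1"
  have fin: "finite (proper_parts V)" using V by (simp add: proper_parts_def)
  have sub: "finite V1 \<and> finite (V - V1)" if "V1 \<in> proper_parts V" for V1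
    using that V finite_subset by (auto simp: proper_parts_def)
  have "?D \<subseteq> grafts V" using lost_rooted_subset by (fastforce simp: grafts_def)
  hence inj: "inj_on graft ?D" by (rule inj_on_subset[OF inj_on_graft])
  have "(\<Sum>p\<in>lost_rooted V. card (V - {snd p})) = (\<Sum>p\<in>lost_rooted V. card V - 1)"
    by (intro sum.cong refl) (use V in \<open>auto simp: lost_rooted_def\<close>)
  hence "(card V - 1) * card (lost_rooted V) = (\<Sum>p\<in>lost_rooted V. card (V - {snd p}))"
    by simp
  also have "\<dots> = card (SIGMA p : lost_rooted V. V - {snd p})"
    using V by (intro card_SigmaI[symmetric] finite_lost_rooted) auto
  also have "\<dots> = card ?D"
    unfolding graft_lost_image[symmetric] by (rule card_image[OF inj])
  also have "\<dots> = (\<Sum>V1\<in>proper_parts V. card (lost_rooted V1 \<times> ?Q V1))"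
    using sub fin V
    by (intro card_SigmaI) (auto intro!: finite_cartesian_product finite_Diff finite_rooted finite_lost_rooted)
  also have "\<dots> = (\<Sum>V1\<in>proper_parts V. card (lost_rooted V1) *
       (card (V - V1) * (2 * card (rooted (V - V1)) - card (lost_rooted (V - V1)))))"
  proof (intro sum.cong refl)
    fix V1 assume V1: "V1 \<in> proper_parts V"
    have "card (?Q V1) = card (rooted (V - V1) \<times> (V - V1) \<times> (UNIV :: bool set)) - card (lost_rooted (V - V1) \<times> (V - V1) \<times> {True})"
      using sub[OF V1] lost_rooted_subset[of "V - V1"]
      by (intro card_Diff_subset) (auto intro: finite_lost_rooted)
    also have "\<dots> = card (V - V1) * (2 * card (rooted (V - V1)) - card (lost_rooted (V - V1)))"
      by (simp add: card_cartesian_product diff_mult_distrib2 mult_ac)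
    finally show "card (lost_rooted V1 \<times> ?Q V1) = card (lost_rooted V1) *
       (card (V - V1) * (2 * card (rooted (V - V1)) - card (lost_rooted (V - V1))))"
      by (simp only: card_cartesian_product)
  qed
  finally show ?thesis .
qed

lemma arc_tree_singleton: "arc_tree {x} E \<longleftrightarrow> E = {}"
proof
  assume "arc_tree {x} E"
  hence "E \<subseteq> {(x, x)}" "(x, x) \<notin> E" by (auto simp: arc_tree_def)
  thus "E = {}" by auto
qed (auto simp: arc_tree_def)

lemma rooted_singleton: "rooted {x} = {({}, x)}" "lost_rooted {x} = {({}, x)}"
  using lost_iff[of "{}" x] by (auto simp: rooted_def lost_rooted_def arc_tree_singleton)

lemma sum_proper_parts:
  fixes f :: "nat \<Rightarrow> nat"
  assumes "finite V"
  shows "(\<Sum>V1\<in>proper_parts V. f (card V1)) = (\<Sum>k=1..card V - 1. (card V choose k) * f k)"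
proof -
  have fin: "finite (proper_parts V)" using assms by (simp add: proper_parts_def)
  have card: "card V1 \<in> {1..card V - 1}" if "V1 \<in> proper_parts V" for V1
  proof -
    have "V1 \<subset> V" "V1 \<noteq> {}" using that by (auto simp: proper_parts_def)
    moreover from this have "finite V1" using assms finite_subset by blast
    ultimately show ?thesis using psubset_card_mono[OF assms, of V1] card_gt_0_iff[of V1] by auto
  qed
  have "(\<Sum>V1\<in>proper_parts V. f (card V1)) =
      (\<Sum>k=1..card V - 1. \<Sum>V1\<in>{V1 \<in> proper_parts V. card V1 = k}. f (card V1))"
    by (rule sum.group[symmetric]) (use fin card in auto)
  also have "\<dots> = (\<Sum>k=1..card V - 1. (card V choose k) * f k)"
  proof (intro sum.cong refl)
    fix k assume "k \<in> {1..card V - 1}"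
    hence "{V1 \<in> proper_parts V. card V1 = k} = {V1. V1 \<subseteq> V \<and> card V1 = k}"
      by (auto simp: proper_parts_def)
    thus "(\<Sum>V1\<in>{V1 \<in> proper_parts V. card V1 = k}. f (card V1)) = (card V choose k) * f k"
      using n_subsets[OF assms, of k] by simp
  qed
  finally show ?thesis .
qed

text \<open>That the counts depend only on the size of \<open>V\<close> is not shown by relabelling:
  for \<open>V\<close> and for \<open>{1..card V}\<close> the right-hand side of the recurrence is
  the same by induction, since it involves proper parts only.\<close>

lemma card_rooted_recurrence:
  fixes V :: "nat set"
  defines "a \<equiv> \<lambda>n. card (rooted {1..n::nat})" and "b \<equiv> \<lambda>n. card (lost_rooted {1..n::nat})"
  assumes "finite V" "V \<noteq> {}"
  shows "card (rooted V) = a (card V)" "card (lost_rooted V) = b (card V)"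
    "(card V - 1) * card (rooted V) = (\<Sum>k=1..card V - 1. (card V choose k) * (a k * ((card V - k) * (2 * a (card V - k)))))"
    "(card V - 1) * card (lost_rooted V) = (\<Sum>k=1..card V - 1. (card V choose k) * (b k * ((card V - k) * (2 * a (card V - k) - b (card V - k)))))"
proof -
  have eqs: "card (rooted V) = a (card V) \<and> card (lost_rooted V) = b (card V) \<and>
    (card V - 1) * card (rooted V) = (\<Sum>k=1..card V - 1. (card V choose k) * (a k * ((card V - k) * (2 * a (card V - k))))) \<and>
    (card V - 1) * card (lost_rooted V) = (\<Sum>k=1..card V - 1. (card V choose k) * (b k * ((card V - k) * (2 * a (card V - k) - b (card V - k)))))"
    using assms(3,4)
  proof (induction "card V" arbitrary: V rule: less_induct)
    case less
    let ?n = "card V"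
    let ?A = "\<Sum>k=1..?n - 1. (?n choose k) * (a k * ((?n - k) * (2 * a (?n - k))))"
    let ?B = "\<Sum>k=1..?n - 1. (?n choose k) * (b k * ((?n - k) * (2 * a (?n - k) - b (?n - k))))"
    \<comment> \<open>For every \<open>W\<close> of the given size, because it is needed for
      \<open>V\<close> and for \<open>{1..?n}\<close>.\<close>
    have step: "(?n - 1) * card (rooted W) = ?A \<and> (?n - 1) * card (lost_rooted W) = ?B"
      if W: "finite W" "card W = ?n" for W :: "nat set"
    proof -
      have parts: "card (rooted V1) = a (card V1)" "card (lost_rooted V1) = b (card V1)"
        "card (rooted (W - V1)) = a (?n - card V1)" "card (lost_rooted (W - V1)) = b (?n - card V1)"
        "card (W - V1) = ?n - card V1" if V1: "V1 \<in> proper_parts W" for V1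
      proof -
        have f: "finite V1" "V1 \<noteq> {}" "W - V1 \<noteq> {}" "V1 \<subseteq> W" "V1 \<subset> W"
          using V1 W finite_subset by (auto simp: proper_parts_def)
        show c: "card (W - V1) = ?n - card V1" using f W by (simp add: card_Diff_subset)
        have lt: "card V1 < ?n" using psubset_card_mono[OF W(1) f(5)] W(2) by simp
        have "card V1 > 0" using f by (simp add: card_gt_0_iff)
        hence lt': "card (W - V1) < ?n" using c lt by simp
        show "card (rooted V1) = a (card V1)" "card (lost_rooted V1) = b (card V1)"
          using less.hyps[OF lt] f by auto
        show "card (rooted (W - V1)) = a (?n - card V1)" "card (lost_rooted (W - V1)) = b (?n - card V1)"
          using less.hyps[OF lt'] f W c by auto
      qed
      have "(?n - 1) * card (rooted W) = (\<Sum>V1\<in>proper_parts W. a (card V1) * ((?n - card V1) * (2 * a (?n - card V1))))"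
        using card_rooted_step[OF W(1)] W(2) parts by simp
      moreover have "(?n - 1) * card (lost_rooted W) = (\<Sum>V1\<in>proper_parts W. b (card V1) * ((?n - card V1) * (2 * a (?n - card V1) - b (?n - card V1))))"
        using card_lost_rooted_step[OF W(1)] W(2) parts by simp
      ultimately show ?thesis
        using sum_proper_parts[OF W(1), of "\<lambda>k. a k * ((?n - k) * (2 * a (?n - k)))"]
          sum_proper_parts[OF W(1), of "\<lambda>k. b k * ((?n - k) * (2 * a (?n - k) - b (?n - k)))"]
        by (simp only: W(2))
    qed
    \<comment> \<open>Size 1 is separate: there the factor \<open>?n - 1\<close> is zero and cannot
      be cancelled.\<close>
    have eq: "card (rooted V) = a ?n \<and> card (lost_rooted V) = b ?n"
    proof (cases "?n = 1")
      case True
      then obtain x where "V = {x}" by (auto simp: card_1_singleton_iff)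
      thus ?thesis by (simp add: a_def b_def rooted_singleton)
    next
      case False
      moreover have "?n > 0" using less.prems by (simp add: card_gt_0_iff)
      ultimately have "?n - 1 > 0" by simp
      moreover have "(?n - 1) * card (rooted V) = (?n - 1) * a ?n" "(?n - 1) * card (lost_rooted V) = (?n - 1) * b ?n"
        using step[OF less.prems(1) refl] step[of "{1..?n}"] by (simp_all add: a_def b_def)
      ultimately show ?thesis by simp
    qed
    show ?case using eq step[OF less.prems(1) refl] by simp
  qed
  thus "card (rooted V) = a (card V)" "card (lost_rooted V) = b (card V)"
    "(card V - 1) * card (rooted V) = (\<Sum>k=1..card V - 1. (card V choose k) * (a k * ((card V - k) * (2 * a (card V - k)))))"
    "(card V - 1) * card (lost_rooted V) = (\<Sum>k=1..card V - 1. (card V choose k) * (b k * ((card V - k) * (2 * a (card V - k) - b (card V - k)))))"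
    by blast+
qed

section \<open>Digraphs, kernels and the game\<close>

lemma conn_imp_reachable:
  assumes E: "E \<subseteq> V \<times> V" and u: "u \<in> V" and uv: "(u, v) \<in> conn E"
  shows "(u, v) \<in> rtrancl_on V (E \<union> E\<inverse>)"
  using uv
proof (induction rule: conn_induct)
  case refl
  thus ?case using u by (rule rtrancl_on_refl)
next
  case (step y z)
  thus ?case using E by (intro rtrancl_on_into_rtrancl_on[OF step.IH]) auto
qed

lemma parcs_mk_symmetric_pair:
  "parcs (mk_symmetric (with_proj G)) = parcs G \<union> (parcs G)\<inverse>"
  by (auto simp: parcs_mk_symmetric)

lemma pair_wf_mk_symmetric:
  assumes "parcs G \<subseteq> pverts G \<times> pverts G"
  shows "pair_wf_digraph (mk_symmetric (with_proj G))"
  using assms by unfold_locales (auto simp: parcs_mk_symmetric_pair)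

lemma pair_digraph_iff:
  "pair_digraph G \<longleftrightarrow> finite (pverts G) \<and> parcs G \<subseteq> pverts G \<times> pverts G \<and> (\<forall>v. (v, v) \<notin> parcs G)"
  (is "?L \<longleftrightarrow> ?R")
proof
  assume ?L
  then interpret pair_digraph G .
  show ?R using pair_finite_verts wellformed' pair_no_loops by fastforce
next
  assume R: ?R
  hence "finite (parcs G)" using finite_subset[of "parcs G" "pverts G \<times> pverts G"] by auto
  with R show ?L by unfold_locales auto
qed

lemma connected_with_proj_iff:
  assumes "parcs G \<subseteq> pverts G \<times> pverts G"
  shows "Digraph_Component.connected (with_proj G) \<longleftrightarrow>
    pverts G \<noteq> {} \<and> (\<forall>x\<in>pverts G. \<forall>y\<in>pverts G. (x, y) \<in> conn (parcs G))"
proof -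
  have "(x, y) \<in> rtrancl_on (pverts G) (parcs G \<union> (parcs G)\<inverse>) \<longleftrightarrow> (x, y) \<in> conn (parcs G)"
    if "x \<in> pverts G" for x y
  proof
    assume "(x, y) \<in> rtrancl_on (pverts G) (parcs G \<union> (parcs G)\<inverse>)"
    thus "(x, y) \<in> conn (parcs G)" unfolding conn_def by (rule rtrancl_on_rtranclI)
  qed (rule conn_imp_reachable[OF assms that])
  thus ?thesis
    unfolding Digraph_Component.connected_def strongly_connected_def reachable_def with_proj_simps
      pverts_mk_symmetric parcs_mk_symmetric_pair by simp
qed

lemma undirected_cycle_iff:
  assumes "parcs G \<subseteq> pverts G \<times> pverts G"
  shows "undirected_cycle G p \<longleftrightarrow> (\<exists>u. u \<in> pverts G \<and> set p \<subseteq> parcs G \<union> (parcs G)\<inverse> \<and> pcas u p u \<and>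
            distinct (tl (pawalk_verts u p)) \<and> 3 \<le> length p)"
proof -
  have "p \<noteq> []" if "3 \<le> length p" using that by auto
  thus ?thesis
    unfolding undirected_cycle_def pre_digraph.cycle_def pre_digraph.awalk_def cas_with_proj_eq
      awalk_verts_with_proj_eq with_proj_simps pverts_mk_symmetric parcs_mk_symmetric_pair by blast
qed

lemma pcas_append: "pcas u (p @ q) v \<longleftrightarrow> (\<exists>w. pcas u p w \<and> pcas w q v)"
  by (induction p arbitrary: u) auto

lemma pawalk_verts_snoc: "pcas u p v \<Longrightarrow> pawalk_verts u (p @ [(v, w)]) = pawalk_verts u p @ [w]"
  by (induction p arbitrary: u) auto

lemma last_pawalk_verts: "pcas u p v \<Longrightarrow> v \<in> set (pawalk_verts u p)"
  by (induction p arbitrary: u) auto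

lemma fst_pawalk_verts: "f \<in> set p \<Longrightarrow> pcas u p v \<Longrightarrow> fst f \<in> set (pawalk_verts u p) \<and> snd f \<in> set (pawalk_verts u p)"
proof (induction p arbitrary: u)
  case (Cons e p)
  have "snd e \<in> set (pawalk_verts (snd e) p)" by (cases p) (use Cons.prems in auto)
  thus ?case using Cons by auto
qed simp

lemma pcas_conn: "pcas u p v \<Longrightarrow> set p \<subseteq> E \<union> E\<inverse> \<Longrightarrow> (u, v) \<in> conn E"
proof (induction p arbitrary: u)
  case (Cons e p)
  hence "(u, snd e) \<in> conn E" using conn_arc[of u "snd e" E] conn_sym[OF conn_arc[of "snd e" u E]] by (cases e) auto
  thus ?case using Cons by (auto intro: conn_trans)
qed auto

text \<open>A simple path from \<open>u\<close> to \<open>v\<close> that avoids the arc is closed to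
  a cycle by traversing the arc backwards.\<close>

lemma ex_cycle_if_conn:
  assumes E: "parcs G \<subseteq> pverts G \<times> pverts G" and uv: "(u, v) \<in> parcs G" "(v, u) \<notin> parcs G" "u \<noteq> v"
    and con: "(u, v) \<in> conn (parcs G - {(u, v)})"
  shows "\<exists>p. undirected_cycle G p"
proof -
  define G' where "G' = \<lparr>pverts = pverts G, parcs = parcs G - {(u, v)}\<rparr>"
  have E': "parcs G' \<subseteq> pverts G' \<times> pverts G'" using E by (auto simp: G'_def)
  interpret S: pair_wf_digraph "mk_symmetric (with_proj G')" by (rule pair_wf_mk_symmetric[OF E'])
  have "(u, v) \<in> rtrancl_on (pverts G') (parcs G' \<union> (parcs G')\<inverse>)"
    by (rule conn_imp_reachable[OF E']) (use uv E con in \<open>auto simp: G'_def\<close>)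
  hence "u \<rightarrow>\<^sup>*\<^bsub>with_proj (mk_symmetric (with_proj G'))\<^esub> v"
    by (simp add: reachable_def parcs_mk_symmetric_pair)
  then obtain p where "S.apath u p v" using S.reachable_apath by blast
  hence p: "pcas u p v" "set p \<subseteq> parcs G' \<union> (parcs G')\<inverse>" "distinct (pawalk_verts u p)"
    unfolding S.apath_def S.awalk_def by (simp_all add: parcs_mk_symmetric_pair)
  have sub: "parcs G' \<subseteq> parcs G" "(u, v) \<notin> parcs G'" "(v, u) \<notin> parcs G'" using uv by (auto simp: G'_def)
  let ?c = "p @ [(v, u)]"
  \<comment> \<open>Length 0 would force \<open>u = v\<close>, and length 1 would use
    \<open>(u, v)\<close> or its reverse; this yields the three arcs demanded of an undirected
    cycle.\<close>
  have "length p \<ge> 2"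
  proof (rule ccontr)
    assume "\<not> length p \<ge> 2"
    hence "length p = 0 \<or> length p = 1" by linarith
    then consider "p = []" | e where "p = [e]" by (auto simp: length_Suc_conv)
    thus False using p sub uv by cases auto
  qed
  moreover have "pcas u ?c u" using p(1) unfolding pcas_append by (intro exI[of _ v]) simp
  moreover obtain vs where vs: "pawalk_verts u p = u # vs" using p(1) by (cases p) auto
  hence "distinct (tl (pawalk_verts u ?c))" using p by (simp add: pawalk_verts_snoc[OF p(1)])
  moreover have "set ?c \<subseteq> parcs G \<union> (parcs G)\<inverse>" "u \<in> pverts G" using p sub uv E by auto
  ultimately show ?thesis unfolding undirected_cycle_iff[OF E]
    by (intro exI[of _ ?c] exI[of _ u]) auto
qed

text \<open>The rest of the cycle bypasses its first edge. That edge may be traversed against its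
  orientation, so \<open>e\<close> is whichever of the two directions is an arc of
  \<open>G\<close>.\<close>

lemma conn_if_cycle:
  assumes E: "parcs G \<subseteq> pverts G \<times> pverts G" and c: "undirected_cycle G p"
  shows "\<exists>e\<in>parcs G. e \<in> conn (parcs G - {e})"
proof -
  obtain u where u: "set p \<subseteq> parcs G \<union> (parcs G)\<inverse>" "pcas u p u" "distinct (tl (pawalk_verts u p))" "3 \<le> length p"
    using c unfolding undirected_cycle_iff[OF E] by blast
  then obtain b w q where p: "p = (u, b) # (b, w) # q"
    by (cases p rule: list.exhaust; cases "tl p") (auto simp: prod_eq_iff)
  have bq: "pcas w q u" "b \<notin> set (pawalk_verts w q)" "distinct (pawalk_verts w q)"
    using u p by auto
  have q: "q \<noteq> []" using u p by auto
  have wu: "w \<noteq> u"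
  proof
    assume "w = u"
    obtain f q' where "q = f # q'" using q by (cases q) auto
    thus False using bq \<open>w = u\<close> last_pawalk_verts[of "snd f" q' u] by auto
  qed
  have bu: "b \<noteq> u" using bq(2) last_pawalk_verts[OF bq(1)] by auto
  define e where "e = (if (u, b) \<in> parcs G then (u, b) else (b, u))"
  have e: "e \<in> parcs G" using u p by (auto simp: e_def)
  \<comment> \<open>The cycle does not return to \<open>b\<close>, so no arc of \<open>q\<close>
    touches \<open>b\<close>, and \<open>w \<noteq> u\<close> keeps \<open>(b, w)\<close> from being
    the first edge reversed.\<close>
  have "set ((b, w) # q) \<subseteq> (parcs G - {(u, b), (b, u)}) \<union> (parcs G - {(u, b), (b, u)})\<inverse>"
  proof
    fix f assume f: "f \<in> set ((b, w) # q)"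
    have "f \<noteq> (u, b)" "f \<noteq> (b, u)"
      using f wu bu bq fst_pawalk_verts[of f q w u] by auto
    moreover have "f \<in> parcs G \<union> (parcs G)\<inverse>" using f u p by auto
    ultimately show "f \<in> (parcs G - {(u, b), (b, u)}) \<union> (parcs G - {(u, b), (b, u)})\<inverse>" by auto
  qed
  hence "(b, u) \<in> conn (parcs G - {(u, b), (b, u)})"
    using bq(1) by (intro pcas_conn[of b "(b, w) # q" u]) auto
  hence bu_conn: "(b, u) \<in> conn (parcs G - {e})" by (rule conn_mono) (auto simp: e_def)
  hence "e \<in> conn (parcs G - {e})" using conn_sym[OF bu_conn] by (auto simp: e_def)
  thus ?thesis using e by blast
qed

text \<open>An arc fails to be a bridge iff it is a loop, has an opposite arc, or can be bypassed in
  a way that closes to an undirected cycle. The three exclusions in \<open>directed_tree\<close>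
  together thus amount to the bridge condition.\<close>

lemma directed_tree_iff_arc_tree: "directed_tree G \<longleftrightarrow> arc_tree (pverts G) (parcs G)"
proof (cases "parcs G \<subseteq> pverts G \<times> pverts G")
  case sub: True
  have antisym: "(v, u) \<notin> parcs G" if br: "\<forall>e\<in>parcs G. e \<notin> conn (parcs G - {e})" and uv: "(u, v) \<in> parcs G" for u v
  proof
    assume vu: "(v, u) \<in> parcs G"
    have "(u, v) \<in> conn (parcs G - {(u, v)})"
      by (cases "u = v") (use vu in \<open>auto intro!: conn_sym[OF conn_arc]\<close>)
    thus False using br uv by blast
  qed
  show ?thesis
  proof
    assume T: "directed_tree G"
    have loop: "(v, v) \<notin> parcs G" and asym: "(u, v) \<in> parcs G \<Longrightarrow> (v, u) \<notin> parcs G"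
      and fin: "finite (pverts G)" and nocyc: "\<nexists>p. undirected_cycle G p"
      and con: "Digraph_Component.connected (with_proj G)" for u v
      using T by (auto simp: directed_tree_def pair_digraph_iff)
    have "e \<notin> conn (parcs G - {e})" if "e \<in> parcs G" for e
    proof (cases e)
      case (Pair u v)
      moreover have "u \<noteq> v" using that Pair loop by auto
      ultimately show ?thesis using ex_cycle_if_conn[OF sub, of u v] that asym nocyc by auto
    qed
    thus "arc_tree (pverts G) (parcs G)"
      using fin sub con by (simp add: arc_tree_def connected_with_proj_iff[OF sub])
  next
    assume T: "arc_tree (pverts G) (parcs G)"
    hence br: "\<forall>e\<in>parcs G. e \<notin> conn (parcs G - {e})" by (simp add: arc_tree_def)
    show "directed_tree G"
      unfolding directed_tree_def pair_digraph_iff connected_with_proj_iff[OF sub]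
      using T antisym[OF br] conn_if_cycle[OF sub] br by (auto simp: arc_tree_def)
  qed
qed (auto simp: directed_tree_def pair_digraph_iff arc_tree_def)

text \<open>A kernel is a solution of "\<open>v\<close> is in \<open>K\<close> iff no out-neighbour
  of \<open>v\<close> is", the recursion satisfied by \<open>lost\<close>. Well-founded induction
  gives uniqueness, and \<open>lost_iff\<close> gives existence.\<close>

lemma is_kernel_iff:
  assumes T: "arc_tree (pverts G) (parcs G)"
  shows "is_kernel G K \<longleftrightarrow> K = {v \<in> pverts G. lost (parcs G) v}"
proof -
  let ?E = "parcs G" and ?V = "pverts G"
  note wf = arc_tree_wf[OF T]
  have sub: "?E \<subseteq> ?V \<times> ?V" "?V \<noteq> {}" using T by (auto simp: arc_tree_def)
  have kernel: "is_kernel G K \<longleftrightarrow> K \<subseteq> ?V \<and> (\<forall>v\<in>?V. v \<in> K \<longleftrightarrow> (\<forall>w. (v, w) \<in> ?E \<longrightarrow> w \<notin> K))" for K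
  proof
    assume K: "is_kernel G K"
    hence "K \<subseteq> ?V" "\<And>v w. v \<in> K \<Longrightarrow> w \<in> K \<Longrightarrow> (v, w) \<notin> ?E"
      "\<And>v. v \<in> ?V \<Longrightarrow> v \<notin> K \<Longrightarrow> \<exists>w. (v, w) \<in> ?E \<and> w \<in> K"
      unfolding is_kernel_def by auto
    thus "K \<subseteq> ?V \<and> (\<forall>v\<in>?V. v \<in> K \<longleftrightarrow> (\<forall>w. (v, w) \<in> ?E \<longrightarrow> w \<notin> K))" by metis
  next
    assume K: "K \<subseteq> ?V \<and> (\<forall>v\<in>?V. v \<in> K \<longleftrightarrow> (\<forall>w. (v, w) \<in> ?E \<longrightarrow> w \<notin> K))"
    have 1: "\<exists>w\<in>K. (v, w) \<in> ?E" if "v \<in> ?V - K" for v using K that by auto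
    have 2: "(v, w) \<notin> ?E" if "v \<in> K" "w \<in> K" for v w using K that by auto
    \<comment> \<open>A vertex outside \<open>K\<close> has an out-neighbour in \<open>K\<close>, so
      the equivalence already forces \<open>K\<close> to be nonempty.\<close>
    obtain v where "v \<in> ?V" using sub by auto
    hence "K \<noteq> {}" using 1[of v] by auto
    thus "is_kernel G K" unfolding is_kernel_def using K 1 2 by simp
  qed
  show ?thesis
  proof
    assume K: "is_kernel G K"
    have "v \<in> ?V \<longrightarrow> (v \<in> K \<longleftrightarrow> lost ?E v)" for v
      using wf
    proof (induction v rule: wf_induct_rule)
      case (less v)
      show ?case
      proof
        assume v: "v \<in> ?V"
        have "(w \<in> K) = lost ?E w" if "(v, w) \<in> ?E" for w
          using less[of w] that sub by auto
        thus "v \<in> K \<longleftrightarrow> lost ?E v"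
          using K v lost_iff[OF wf, of v] unfolding kernel by blast
      qed
    qed
    thus "K = {v \<in> ?V. lost ?E v}" using K unfolding kernel by blast
  next
    assume K: "K = {v \<in> ?V. lost ?E v}"
    have "v \<in> K \<longleftrightarrow> (\<forall>w. (v, w) \<in> ?E \<longrightarrow> w \<notin> K)" if "v \<in> ?V" for v
      unfolding K using that sub lost_iff[OF wf, of v] by auto
    thus "is_kernel G K" unfolding kernel using K by blast
  qed
qed

section \<open>The game\<close>

lemma vwalk_snoc:
  assumes "p \<noteq> []"
  shows "vwalk (p @ [w]) (with_proj G) \<longleftrightarrow> vwalk p (with_proj G) \<and> w \<in> pverts G \<and> (last p, w) \<in> parcs G"
proof -
  have "set (vwalk_arcs (p @ [w])) = set (vwalk_arcs p) \<union> {(last p, w)}"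
    using assms by (induction p rule: vwalk_arcs.induct) auto
  thus ?thesis using assms by (auto simp: vwalk_def)
qed

text \<open>If \<open>length p\<close> is odd, an even number of moves has been made and the first
  player is to move, so only then is \<open>w\<close> prescribed.\<close>

lemma first_player_follows_snoc:
  "first_player_follows \<sigma> (p @ [w]) \<longleftrightarrow> first_player_follows \<sigma> p \<and> (p \<noteq> [] \<and> odd (length p) \<longrightarrow> w = \<sigma> p)"
proof
  assume L: "first_player_follows \<sigma> (p @ [w])"
  have "first_player_follows \<sigma> p"
    unfolding first_player_follows_def
  proof (intro allI impI)
    fix i assume i: "even i \<and> Suc i < length p"
    hence "(p @ [w]) ! Suc i = \<sigma> (take (Suc i) (p @ [w]))"
      using L unfolding first_player_follows_def by auto
    thus "p ! Suc i = \<sigma> (take (Suc i) p)" using i by (simp add: nth_append)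
  qed
  moreover have "w = \<sigma> p" if p: "p \<noteq> []" "odd (length p)"
  proof -
    obtain i where i: "length p = Suc i" using p by (cases p) auto
    hence "(p @ [w]) ! Suc i = \<sigma> (take (Suc i) (p @ [w]))"
      using L p unfolding first_player_follows_def by auto
    thus ?thesis using i by (simp add: nth_append)
  qed
  ultimately show "first_player_follows \<sigma> p \<and> (p \<noteq> [] \<and> odd (length p) \<longrightarrow> w = \<sigma> p)" by blast
next
  assume R: "first_player_follows \<sigma> p \<and> (p \<noteq> [] \<and> odd (length p) \<longrightarrow> w = \<sigma> p)"
  show "first_player_follows \<sigma> (p @ [w])"
    unfolding first_player_follows_def
  proof (intro allI impI)
    fix i assume i: "even i \<and> Suc i < length (p @ [w])"
    show "(p @ [w]) ! Suc i = \<sigma> (take (Suc i) (p @ [w]))"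
    proof (cases "Suc i < length p")
      case True
      thus ?thesis using R i by (simp add: nth_append first_player_follows_def)
    next
      case False
      hence "length p = Suc i" using i by simp
      thus ?thesis using R i by (auto simp: nth_append)
    qed
  qed
qed

text \<open>At a lost root every strategy of the first player is refuted by some play; otherwise
  always moving to a lost position wins. Plays end because the digraph is well-founded.\<close>

lemma first_player_wins_iff:
  assumes T: "arc_tree (pverts G) (parcs G)" and r: "r \<in> pverts G"
  shows "first_player_wins G r \<longleftrightarrow> \<not> lost (parcs G) r"
proof -
  let ?E = "parcs G" and ?W = "with_proj G"
  have sub: "?E \<subseteq> pverts G \<times> pverts G" using T by (auto simp: arc_tree_def)
  note lost_iff = lost_iff[OF arc_tree_wf[OF T]]
  \<comment> \<open>Induction over \<open>lost\<close> from any position where the first player is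
    to move: the rule supplies the second player's reply to \<open>\<sigma> p\<close>. A final walk
    of odd length means an even number of moves.\<close>
  have "\<exists>q. complete_play G r q \<and> first_player_follows \<sigma> q \<and> odd (length q)"
    if \<sigma>: "strategy G \<sigma>" and "lost ?E v" "vwalk p ?W" "hd p = r" "last p = v" "odd (length p)" "first_player_follows \<sigma> p"
    for \<sigma> v p
    using that(2-)
  proof (induction v arbitrary: p rule: lost.induct)
    case (lostI v p)
    show ?case
    proof (cases "can_move G p")
      case False
      thus ?thesis using lostI.prems by (auto simp: complete_play_def)
    next
      case True
      hence "(v, \<sigma> p) \<in> ?E" using \<sigma> lostI.prems unfolding strategy_def by blast
      then obtain u where u: "(\<sigma> p, u) \<in> ?E"
        and IH: "\<And>q. vwalk q ?W \<Longrightarrow> hd q = r \<Longrightarrow> last q = u \<Longrightarrow> odd (length q) \<Longrightarrow>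
          first_player_follows \<sigma> q \<Longrightarrow> \<exists>q. complete_play G r q \<and> first_player_follows \<sigma> q \<and> odd (length q)"
        using lostI.IH by blast
      have "p \<noteq> []" using lostI.prems by auto
      hence "vwalk ((p @ [\<sigma> p]) @ [u]) ?W"
        using lostI.prems u \<open>(v, \<sigma> p) \<in> ?E\<close> sub by (subst vwalk_snoc; simp)+ auto
      moreover have "first_player_follows \<sigma> ((p @ [\<sigma> p]) @ [u])"
        using lostI.prems by (simp only: first_player_follows_snoc) simp
      ultimately show ?thesis using \<open>p \<noteq> []\<close> lostI.prems by (intro IH) simp_all
    qed
  qed
  note play = this
  have "\<not> first_player_wins G r" if lost: "lost ?E r"
  proof
    assume "first_player_wins G r"
    then obtain \<sigma> where \<sigma>: "strategy G \<sigma>"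
      "\<And>p. complete_play G r p \<Longrightarrow> first_player_follows \<sigma> p \<Longrightarrow> odd (length p - 1)"
      unfolding first_player_wins_def by blast
    obtain q where q: "complete_play G r q" "first_player_follows \<sigma> q" "odd (length q)"
      using play[OF \<sigma>(1) lost, of "[r]"] r by (auto simp: vwalk_def first_player_follows_def)
    thus False using \<sigma>(2)[OF q(1,2)] by simp
  qed
  moreover have "first_player_wins G r" if won: "\<not> lost ?E r"
  proof -
    \<comment> \<open>The fallback branch serves positions without a lost successor:
      \<open>strategy\<close> demands a legal move at every walk that can be extended, including
      those that never arise in play.\<close>
    define \<sigma> where "\<sigma> = (\<lambda>p. if \<exists>w. (last p, w) \<in> ?E \<and> lost ?E w then SOME w. (last p, w) \<in> ?E \<and> lost ?E w
                           else SOME w. (last p, w) \<in> ?E)"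
    have \<sigma>1: "(last p, \<sigma> p) \<in> ?E \<and> lost ?E (\<sigma> p)" if "\<not> lost ?E (last p)" for p
    proof -
      have ex: "\<exists>w. (last p, w) \<in> ?E \<and> lost ?E w" using that lost_iff[of "last p"] by blast
      thus ?thesis using someI_ex[OF ex] by (simp add: \<sigma>_def)
    qed
    have \<sigma>2: "(last p, \<sigma> p) \<in> ?E" if "can_move G p" for p
    proof (cases "lost ?E (last p)")
      case True
      hence "\<not> (\<exists>w. (last p, w) \<in> ?E \<and> lost ?E w)" using lost_iff[of "last p"] by blast
      thus ?thesis using that someI_ex[of "\<lambda>w. (last p, w) \<in> ?E"] by (auto simp: \<sigma>_def can_move_def)
    qed (use \<sigma>1 in blast)
    \<comment> \<open>Positions with the second player to move, and only those, are lost; a complete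
      play ends in a lost position, hence on the second player's turn.\<close>
    have inv: "lost ?E (last p) \<longleftrightarrow> even (length p)"
      if "vwalk p ?W" "hd p = r" "first_player_follows \<sigma> p" for p
      using that
    proof (induction p rule: rev_induct)
      case (snoc w p)
      show ?case
      proof (cases "p = []")
        case True
        thus ?thesis using snoc.prems won by simp
      next
        case False
        have IH: "lost ?E (last p) \<longleftrightarrow> even (length p)"
          using snoc False by (auto simp: vwalk_snoc first_player_follows_snoc)
        have pw: "(last p, w) \<in> ?E" using snoc.prems False by (auto simp: vwalk_snoc)
        show ?thesis
        proof (cases "even (length p)")
          case True
          hence "\<not> lost ?E w" using IH pw lost_iff[of "last p"] by blast
          thus ?thesis using True by simp
        next
          case odd: False
          hence "w = \<sigma> p" using snoc.prems False by (simp add: first_player_follows_snoc)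
          thus ?thesis using odd IH \<sigma>1[of p] by simp
        qed
      qed
    qed (simp add: vwalk_def)
    have "odd (length p - 1)" if p: "complete_play G r p" "first_player_follows \<sigma> p" for p
    proof -
      have "lost ?E (last p)"
        using p lost_iff[of "last p"] by (auto simp: complete_play_def can_move_def)
      hence "even (length p)" using inv[of p] p by (auto simp: complete_play_def)
      moreover have "length p > 0" using p by (auto simp: complete_play_def vwalk_def)
      ultimately show ?thesis by simp
    qed
    thus ?thesis using \<sigma>2 unfolding first_player_wins_def strategy_def by blast
  qed
  ultimately show ?thesis by blast
qed

section \<open>The limit\<close>

lemma rooted_directed_trees_eq:
  "rooted_directed_trees n = (\<lambda>(E, r). (\<lparr>pverts = {1..n}, parcs = E\<rparr>, r)) ` rooted {1..n}"
proof (intro equalityI subsetI)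
  fix x assume "x \<in> rooted_directed_trees n"
  then obtain G r where x: "x = (G, r)" and G: "arc_tree (pverts G) (parcs G)" "pverts G = {1..n}" "r \<in> {1..n}"
    by (auto simp: rooted_directed_trees_def directed_tree_iff_arc_tree)
  have "G = \<lparr>pverts = {1..n}, parcs = parcs G\<rparr>" using G by (cases G) simp
  moreover have "(parcs G, r) \<in> rooted {1..n}" using G by (simp add: rooted_def)
  ultimately show "x \<in> (\<lambda>(E, r). (\<lparr>pverts = {1..n}, parcs = E\<rparr>, r)) ` rooted {1..n}"
    unfolding x by (intro image_eqI[of _ _ "(parcs G, r)"]) auto
qed (auto simp: rooted_directed_trees_def directed_tree_iff_arc_tree rooted_def)

lemma t_num_eq: "t_num n = card (rooted {1..n})"
  unfolding t_num_def rooted_directed_trees_eq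
  by (rule card_image) (auto simp: inj_on_def)

lemma ex1_kernel:
  assumes "directed_tree G"
  shows "\<exists>!K. is_kernel G K"
  using assms by (auto simp: directed_tree_iff_arc_tree is_kernel_iff)

lemma the_kernel_eq:
  assumes "directed_tree G"
  shows "the_kernel G = {v \<in> pverts G. lost (parcs G) v}"
  using assms by (auto simp: the_kernel_def directed_tree_iff_arc_tree is_kernel_iff)

lemma green_rooted_eq:
  "{(G, r). (G, r) \<in> rooted_directed_trees n \<and> r \<notin> the_kernel G} =
     (\<lambda>(E, r). (\<lparr>pverts = {1..n}, parcs = E\<rparr>, r)) ` (rooted {1..n} - lost_rooted {1..n})"
  (is "?L = ?\<phi> ` ?D")
proof -
  have "?L = {x \<in> rooted_directed_trees n. snd x \<notin> the_kernel (fst x)}" by auto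
  also have "\<dots> = ?\<phi> ` {x \<in> rooted {1..n}. snd (?\<phi> x) \<notin> the_kernel (fst (?\<phi> x))}"
    unfolding rooted_directed_trees_eq by blast
  also have "{x \<in> rooted {1..n}. snd (?\<phi> x) \<notin> the_kernel (fst (?\<phi> x))} = ?D"
    by (auto simp: rooted_def lost_rooted_def the_kernel_eq directed_tree_iff_arc_tree)
  finally show ?thesis .
qed

lemma g_num_eq: "g_num n = card (rooted {1..n}) - card (lost_rooted {1..n})"
proof -
  have "g_num n = card (rooted {1..n} - lost_rooted {1..n})"
    unfolding g_num_def green_rooted_eq by (rule card_image) (auto simp: inj_on_def)
  also have "\<dots> = card (rooted {1..n}) - card (lost_rooted {1..n})"
    by (rule card_Diff_subset) (auto intro: finite_lost_rooted simp: lost_rooted_subset)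
  finally show ?thesis .
qed

text \<open>Division by factorials absorbs the binomial coefficient and turns the binomial
  convolution into the ordinary one of exponential generating functions.\<close>

lemma coeff_recurrence_rooted:
  "coeff_recurrence (\<lambda>n. of_nat (card (rooted {1..n})) / fact n :: 'a::field_char_0)
     (\<lambda>n. of_nat (card (lost_rooted {1..n})) / fact n)"
proof -
  define a b where "a = (\<lambda>n. card (rooted {1..n::nat}))" and "b = (\<lambda>n. card (lost_rooted {1..n::nat}))"
  have ab: "b n \<le> a n" for n
    unfolding a_def b_def by (intro card_mono finite_rooted lost_rooted_subset) auto
  have rec: "(n - 1) * a n = (\<Sum>k=1..n-1. (n choose k) * (a k * ((n - k) * (2 * a (n - k)))))"
    "(n - 1) * b n = (\<Sum>k=1..n-1. (n choose k) * (b k * ((n - k) * (2 * a (n - k) - b (n - k)))))" if "n \<ge> 2" for n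
    using card_rooted_recurrence(3,4)[of "{1..n}"] that by (simp_all add: a_def b_def)
  have binom: "(of_nat (n choose k) / fact n :: 'a) = 1 / (fact k * fact (n - k))" if "k \<in> {1..n-1}" for n k
    using that by (subst binomial_fact) auto
  have "(of_nat n - 1) * (of_nat (a n) / fact n :: 'a) =
      (\<Sum>k=1..n-1. of_nat (a k) / fact k * (of_nat (n - k) * (2 * (of_nat (a (n - k)) / fact (n - k)))))"
    if n: "n \<ge> 2" for n
  proof -
    have "(of_nat n - 1) * (of_nat (a n) / fact n :: 'a) = of_nat ((n - 1) * a n) / fact n"
      using n by (simp add: of_nat_diff)
    also have "\<dots> = (\<Sum>k=1..n-1. of_nat (n choose k) / fact n * (of_nat (a k) * (of_nat (n - k) * (2 * of_nat (a (n - k))))))"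
      unfolding rec(1)[OF n] of_nat_sum sum_divide_distrib by simp
    also have "\<dots> = (\<Sum>k=1..n-1. of_nat (a k) / fact k * (of_nat (n - k) * (2 * (of_nat (a (n - k)) / fact (n - k)))))"
      by (intro sum.cong refl) (simp add: binom)
    finally show ?thesis .
  qed
  moreover have "(of_nat n - 1) * (of_nat (b n) / fact n :: 'a) =
      (\<Sum>k=1..n-1. of_nat (b k) / fact k * (of_nat (n - k) * (2 * (of_nat (a (n - k)) / fact (n - k)) - of_nat (b (n - k)) / fact (n - k))))"
    if n: "n \<ge> 2" for n
  proof -
    \<comment> \<open>The subtraction of natural numbers is exact because there are at most as many
      lost rooted trees as rooted trees.\<close>
    have diff: "of_nat (2 * a m - b m) = (2 * of_nat (a m) - of_nat (b m) :: 'a)" for m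
      using ab[of m] by (simp add: of_nat_diff)
    have "(of_nat n - 1) * (of_nat (b n) / fact n :: 'a) = of_nat ((n - 1) * b n) / fact n"
      using n by (simp add: of_nat_diff)
    also have "\<dots> = (\<Sum>k=1..n-1. of_nat (n choose k) / fact n * (of_nat (b k) * (of_nat (n - k) * (2 * of_nat (a (n - k)) - of_nat (b (n - k))))))"
      unfolding rec(2)[OF n] of_nat_sum sum_divide_distrib of_nat_mult diff by simp
    also have "\<dots> = (\<Sum>k=1..n-1. of_nat (b k) / fact k * (of_nat (n - k) * (2 * (of_nat (a (n - k)) / fact (n - k)) - of_nat (b (n - k)) / fact (n - k))))"
      by (intro sum.cong refl) (simp add: binom right_diff_distrib diff_divide_distrib)
    finally show ?thesis .
  qed
  moreover have "a 1 = 1" "b 1 = 1" by (simp_all add: a_def b_def rooted_singleton)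
  ultimately have "coeff_recurrence (\<lambda>n. of_nat (a n) / fact n :: 'a) (\<lambda>n. of_nat (b n) / fact n)"
    unfolding coeff_recurrence_def by (intro conjI allI impI) simp_all
  thus ?thesis unfolding a_def b_def .
qed

lemma t_num_closed:
  assumes "n \<ge> 1"
  shows "t_num n = (2 * n) ^ (n - 1)"
proof -
  have "real n * (real (t_num n) / fact n) = (2 * real n) ^ (n - 1) / fact (n - 1)"
    using coeff_recurrence_solution(1)[OF coeff_recurrence_rooted assms] by (simp add: t_num_eq)
  moreover have "fact n = real n * fact (n - 1)" using assms by (simp add: fact_reduce)
  ultimately have "real (t_num n) = real ((2 * n) ^ (n - 1))" using assms by simp
  thus ?thesis by (simp only: of_nat_eq_iff)
qed

section \<open>Numerical enclosure of the constant\<close>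

text \<open>At a negative argument the remainder after 8 terms is nonnegative and after 9 terms
  nonpositive, so the two Taylor sums bound \<open>exp\<close> from below and from above.\<close>

lemma exp_minus_bounds:
  "2 * 0.351733 < exp (- 0.351733 :: real)" "exp (- 0.351734 :: real) < 2 * 0.351734"
proof -
  obtain t :: real where t: "exp (- 0.351733) = (\<Sum>m<8. (- 0.351733) ^ m / fact m) + exp t / fact 8 * (- 0.351733) ^ 8"
    using Maclaurin_exp_le[of "- 0.351733" 8] by blast
  have "0 \<le> exp t / fact 8 * (- 0.351733 :: real) ^ 8" by simp
  moreover have "2 * 0.351733 < (\<Sum>m<8. (- 0.351733 :: real) ^ m / fact m)"
    by (simp add: eval_nat_numeral fact_numeral)
  ultimately show "2 * 0.351733 < exp (- 0.351733 :: real)" using t by linarith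
  obtain t :: real where t: "exp (- 0.351734) = (\<Sum>m<9. (- 0.351734) ^ m / fact m) + exp t / fact 9 * (- 0.351734) ^ 9"
    using Maclaurin_exp_le[of "- 0.351734" 9] by blast
  have "exp t / fact 9 * (- 0.351734 :: real) ^ 9 \<le> 0" by (simp add: mult_le_0_iff)
  moreover have "(\<Sum>m<9. (- 0.351734 :: real) ^ m / fact m) < 2 * 0.351734"
    by (simp add: eval_nat_numeral fact_numeral)
  ultimately show "exp (- 0.351734 :: real) < 2 * 0.351734" using t by linarith
qed

text \<open>The equation reads \<open>\<mu> * exp \<mu> = 1 / 2\<close>, so \<open>\<mu>\<close> is
  the Lambert value \<open>W(1/2)\<close>. Existence comes from the sign change of
  \<open>2 * x - exp (- x)\<close>, uniqueness from its strict growth.\<close>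

lemma half_lambert_constant:
  obtains \<mu> :: real where "2 * \<mu> = exp (- \<mu>)" "\<And>x. 2 * x = exp (- x) \<Longrightarrow> x = \<mu>" "0.351733 < \<mu>" "\<mu> < 0.351734"
proof -
  have mono: "2 * x - exp (- x) < 2 * y - exp (- y)" if "x < y" for x y :: real
    using that exp_less_mono[of "- y" "- x"] by linarith
  have "\<exists>\<mu>\<ge>0.351733. \<mu> \<le> 0.351734 \<and> 2 * \<mu> - exp (- \<mu>) = (0::real)"
    using exp_minus_bounds by (intro IVT') (auto intro!: continuous_intros)
  then obtain \<mu> :: real where \<mu>: "0.351733 \<le> \<mu>" "\<mu> \<le> 0.351734" "2 * \<mu> - exp (- \<mu>) = 0" by blast
  show ?thesis
  proof
    show "2 * \<mu> = exp (- \<mu>)" using \<mu> by simp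
    show "x = \<mu>" if "2 * x = exp (- x)" for x
      using mono[of x \<mu>] mono[of \<mu> x] that \<mu>(3) by (cases x \<mu> rule: linorder_cases) auto
    have "2 * 0.351733 - exp (- 0.351733) \<noteq> (0::real)" "2 * 0.351734 - exp (- 0.351734) \<noteq> (0::real)"
      using exp_minus_bounds by linarith+
    hence "\<mu> \<noteq> 0.351733" "\<mu> \<noteq> 0.351734" using \<mu>(3) by metis+
    thus "0.351733 < \<mu>" "\<mu> < 0.351734" using \<mu> by auto
  qed
qed

lemma g_num_ratio_limit:
  fixes \<mu> :: real
  assumes "2 * \<mu> = exp (- \<mu>)"
  shows "(\<lambda>n. real (g_num n) / real (t_num n)) \<longlonglongrightarrow> (1 - \<mu>) / (1 + \<mu>)"
proof -
  have pos: "\<mu> > 0" using assms exp_gt_zero[of "-\<mu>"] by linarith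
  let ?r = "\<lambda>n. real (card (lost_rooted {1..n})) / fact n" and ?t = "\<lambda>n. real (card (rooted {1..n})) / fact n"
  have "(\<lambda>n. 1 - ?r n / ?t n) \<longlonglongrightarrow> 1 - 2 * \<mu> / (1 + \<mu>)"
    by (intro tendsto_diff tendsto_const coeff_recurrence_ratio_limit[OF _ assms] coeff_recurrence_rooted)
  also have "1 - 2 * \<mu> / (1 + \<mu>) = (1 - \<mu>) / (1 + \<mu>)" using pos by (simp add: field_simps)
  finally show ?thesis
  proof (rule Lim_transform_eventually)
    show "\<forall>\<^sub>F n in sequentially. 1 - ?r n / ?t n = real (g_num n) / real (t_num n)"
      using eventually_ge_at_top[of 1]
    proof eventually_elim
      case (elim n)
      have "t_num n > 0" using t_num_closed[OF elim] elim by simp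
      moreover have "card (lost_rooted {1..n}) \<le> card (rooted {1..n})"
        by (intro card_mono finite_rooted lost_rooted_subset) auto
      ultimately show ?case by (simp add: g_num_eq t_num_eq of_nat_diff field_simps)
    qed
  qed
qed

lemma prob_first_player_wins:
  assumes "n \<ge> 1"
  shows "measure_pmf.prob (pmf_of_set (rooted_directed_trees n)) {(G, r). first_player_wins G r} =
    real (g_num n) / real (t_num n)"
proof -
  have fin: "finite (rooted_directed_trees n)"
    unfolding rooted_directed_trees_eq by (intro finite_imageI finite_rooted) auto
  have "t_num n > 0" using t_num_closed[OF assms] assms by simp
  \<comment> \<open>A uniform distribution requires a nonempty finite set; here positivity of
    \<open>t_num n\<close> provides the former.\<close>
  hence ne: "rooted_directed_trees n \<noteq> {}" by (auto simp: t_num_def)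
  have "rooted_directed_trees n \<inter> {(G, r). first_player_wins G r} =
      {(G, r). (G, r) \<in> rooted_directed_trees n \<and> r \<notin> the_kernel G}"
    by (auto simp: rooted_directed_trees_def the_kernel_eq directed_tree_iff_arc_tree first_player_wins_iff)
  thus ?thesis
    using measure_pmf_of_set[OF ne fin] by (simp add: g_num_def t_num_def)
qed

theorem theorem5:
  shows
    "(\<forall>n\<ge>1. t_num n = (2 * n) ^ (n - 1)) \<and>
     (\<forall>n\<ge>1. \<forall>(G, r) \<in> rooted_directed_trees n. \<exists>!K. is_kernel G K) \<and>
     (\<exists>\<mu>::real.
        2 * \<mu> = exp (- \<mu>) \<and>
        (\<forall>x::real. 2 * x = exp (- x) \<longrightarrow> x = \<mu>) \<and>
        \<bar>\<mu> - 0.351733\<bar> < 0.000001 \<and>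
        \<bar>(1 - \<mu>) / (1 + \<mu>) - 0.4795\<bar> < 0.0001 \<and>
        (\<lambda>n. real (g_num n) / real (t_num n)) \<longlonglongrightarrow> (1 - \<mu>) / (1 + \<mu>) \<and>
        (\<lambda>n. measure_pmf.prob (pmf_of_set (rooted_directed_trees n))
               {(G, r). first_player_wins G r}) \<longlonglongrightarrow> (1 - \<mu>) / (1 + \<mu>))"
proof (intro conjI)
  show "\<forall>n\<ge>1. t_num n = (2 * n) ^ (n - 1)" by (simp add: t_num_closed)
  show "\<forall>n\<ge>1. \<forall>(G, r) \<in> rooted_directed_trees n. \<exists>!K. is_kernel G K"
    by (auto simp: rooted_directed_trees_def ex1_kernel)
  obtain \<mu> :: real where \<mu>: "2 * \<mu> = exp (- \<mu>)" "\<And>x. 2 * x = exp (- x) \<Longrightarrow> x = \<mu>"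
    "0.351733 < \<mu>" "\<mu> < 0.351734" using half_lambert_constant by blast
  note lim = g_num_ratio_limit[OF \<mu>(1)]
  have "(\<lambda>n. measure_pmf.prob (pmf_of_set (rooted_directed_trees n)) {(G, r). first_player_wins G r})
      \<longlonglongrightarrow> (1 - \<mu>) / (1 + \<mu>)"
    by (rule Lim_transform_eventually[OF lim])
       (use eventually_ge_at_top[of 1] in eventually_elim, simp add: prob_first_player_wins)
  moreover have "\<bar>(1 - \<mu>) / (1 + \<mu>) - 0.4795\<bar> < 0.0001"
  proof -
    have "(1 - \<mu>) / (1 + \<mu>) < 0.4796" "(1 - \<mu>) / (1 + \<mu>) > 0.4794"
      using \<mu>(3,4) by (simp_all add: divide_less_eq less_divide_eq)
    thus ?thesis by linarith
  qed
  moreover have "\<bar>\<mu> - 0.351733\<bar> < 0.000001" using \<mu>(3,4) by linarith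
  ultimately show "\<exists>\<mu>::real.
        2 * \<mu> = exp (- \<mu>) \<and>
        (\<forall>x::real. 2 * x = exp (- x) \<longrightarrow> x = \<mu>) \<and>
        \<bar>\<mu> - 0.351733\<bar> < 0.000001 \<and>
        \<bar>(1 - \<mu>) / (1 + \<mu>) - 0.4795\<bar> < 0.0001 \<and>
        (\<lambda>n. real (g_num n) / real (t_num n)) \<longlonglongrightarrow> (1 - \<mu>) / (1 + \<mu>) \<and>
        (\<lambda>n. measure_pmf.prob (pmf_of_set (rooted_directed_trees n))
               {(G, r). first_player_wins G r}) \<longlonglongrightarrow> (1 - \<mu>) / (1 + \<mu>)"
    using \<mu>(1,2) lim by blast
qed

end
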